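(* Assume $\dot x=A(t)x$ has a nonuniform exponential dichotomy on $\mathbb{R}_0^+$ with constants $(K,\alpha,\mu)$ and projector $P(\cdot)$ and nonuniform bounded growth with constants $(K_0,a,\varepsilon)$; assume $f$ satisfies (P1) with $(L_f,\theta)$, (P2) with $(M,\delta)$ and (P3); let $b>0$ be such that $$\delta+\mu<\min\{b,\alpha\};\quad \mu\le\theta,\ \varepsilon<\theta,\ \alpha+\mu-\theta+b>0,\ \alpha-\mu+\theta-b>0;\quad \frac{KL_f}{\alpha+\mu-\theta+b}+\frac{KL_f}{\alpha-\mu+\theta-b}<1.$$ Assume in addition that $$\max\{\mu+\alpha-a,\ \mu-(\alpha-a)\}<\theta,\qquad \mu+\varepsilon\le\theta,$$ $$KL_fK_0e^{\frac{L_fK_0}{\theta-\varepsilon}}\max\Big\{\frac{1}{\theta-(\alpha-a)-\mu},\ \frac{1}{\theta+(\alpha-a)-\mu}\Big\}\le\frac1c$$ for some $c>2$. Then there exists $\tilde t_c\in(0,+\infty]$ such that for every $t\in[0,\tilde t_c)$ the map $\eta\mapsto G(t,\eta)$ is a $C^1$-diffeomorphism of $\mathbb{R}^n$.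
   Context: Standing setting: $A\colon\mathbb{R}_0^+\to M_n(\mathbb{R})$ and $f\colon\mathbb{R}_0^+\times\mathbb{R}^n\to\mathbb{R}^n$ continuous; solutions of $\dot y=A(t)y+f(t,y)$ exist on $\mathbb{R}_0^+$ and are unique; $y(s,t,\eta)$ denotes the solution through $\eta$ at time $t$. $\Phi(t,s)=\Phi(t)\Phi^{-1}(s)$ is the evolution operator of $\dot x=A(t)x$; $|\cdot|$ a norm on $\mathbb{R}^n$, $\|\cdot\|$ induced matrix norm. Nonuniform exponential dichotomy with constants $(K,\alpha,\mu)$: projector $P(\cdot)$, $K\ge1$, $\alpha>0$, $0\le\mu<\alpha$, $P(t)\Phi(t,s)=\Phi(t,s)P(s)$ for all $t,s\ge0$, $\|\Phi(t,s)P(s)\|\le Ke^{-\alpha(t-s)+\mu s}$ for $t\ge s\ge0$, $\|\Phi(t,s)(I-P(s))\|\le Ke^{\alpha(t-s)+\mu s}$ for $0\le t\le s$. Green function $\mathcal{G}(t,s)=\Phi(t,s)P(s)$ for $t\ge s\ge0$, $\mathcal{G}(t,s)=-\Phi(t,s)(I-P(s))$ for $s>t\ge0$. Nonuniform bounded growth $(K_0,a,\varepsilon)$: $K_0\ge1,a>0,\varepsilon\ge0$, $\|\Phi(t,s)\|\le K_0e^{a|t-s|+\varepsilon s}$ for all $t,s\ge0$. (P1): $|f(t,y_1)-f(t,y_2)|\le L_fe^{-\theta t}|y_1-y_2|$, $L_f>0,\theta\ge0$. (P2): $|f(t,y)|\le Me^{\delta t}$, $M>0,\delta\ge0$. (P3):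 $\partial_2 f$ (derivative in the state variable) exists and $f,\partial_2f$ are continuous in $(t,x)$. $G$ is the inverse homeomorphism of the topological conjugacy between $\dot x=A(t)x$ and $\dot y=A(t)y+f(t,y)$ given by $G(t,\eta)=\eta-\int_0^{+\infty}\mathcal{G}(t,s)f(s,y(s,t,\eta))\,ds$. *)

theory Defs
  imports "HOL-Analysis.Analysis" "HOL-Library.Extended_Real"
begin

text \<open>An abstract norm on R^n (the paper allows an arbitrary norm).\<close>
definition is_norm :: "(real^'n \<Rightarrow> real) \<Rightarrow> bool" where
  "is_norm N \<longleftrightarrow> (\<forall>x. N x = 0 \<longleftrightarrow> x = 0) \<and> (\<forall>x y. N (x + y) \<le> N x + N y)
      \<and> (\<forall>c x. N (c *\<^sub>R x) = \<bar>c\<bar> * N x)"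

definition mnorm :: "(real^'n \<Rightarrow> real) \<Rightarrow> real^'n^'n \<Rightarrow> real" where
  "mnorm N B = Sup {N (B *v x) | x. N x = 1}"

definition evol :: "(real \<Rightarrow> real^'n^'n) \<Rightarrow> real \<Rightarrow> real \<Rightarrow> real^'n^'n" where
  "evol X t s = X t ** matrix_inv (X s)"

definition green :: "(real \<Rightarrow> real^'n^'n) \<Rightarrow> (real \<Rightarrow> real^'n^'n) \<Rightarrow> real \<Rightarrow> real \<Rightarrow> real^'n^'n" where
  "green X P t s = (if s \<le> t then evol X t s ** P s else - (evol X t s ** (mat 1 - P s)))"

definition C1_map :: "(real^'n \<Rightarrow> real^'n) \<Rightarrow> bool" where
  "C1_map g \<longleftrightarrow> (\<exists>g' :: real^'n \<Rightarrow> real^'n^'n.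
      (\<forall>x. (g has_derivative (\<lambda>h. g' x *v h)) (at x)) \<and> continuous_on UNIV g')"

definition C1_diffeo :: "(real^'n \<Rightarrow> real^'n) \<Rightarrow> bool" where
  "C1_diffeo g \<longleftrightarrow> bij g \<and> C1_map g \<and> C1_map (inv g)"

end

(*
Write G(t, \<cdot>) = id - \<phi>. Bounded growth, (P1) and Gronwall's inequality show that the flow is Lipschitz with
constant K0 exp(\<epsilon> t + a |s - t|) exp(Lf K0 / (\<theta> - \<epsilon>)); integrating this against the Green function gives a
Lipschitz constant of \<phi> which for small t is at most 2/c < 1, since the part coming from s \<le> t vanishes as
t tends to 0. Hence id - \<phi> is bijective by Banach's theorem and its derivative is invertible, as soon as \<phi> is C1.

For the latter, put E = (y_x - y_x') - k (y_z - y_z') where x - x' = k (z - z') and all four initial values are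
close to \<eta>. Then E(t) = 0 and E solves the equation linearised along y_\<eta> up to an error o(|x - x'|), uniformly
on compact time intervals, so Gronwall makes E itself o(|x - x'|). With a tail estimate for the integral, \<phi>
inherits this property, which amounts to strict differentiability at \<eta>.
*)
theory Submission
  imports Defs
begin

section \<open>Arbitrary norms on Euclidean space\<close>

text \<open>The smallness condition refers to an arbitrary norm, and a detour through the Euclidean
  norm would spoil its constants. Integrals are therefore estimated directly in \<open>N\<close>, by
  means of a linear functional that is dominated by \<open>N\<close> and attains it at the value of
  the integral; equivalence of norms enters only where the size of a constant does not matter.

  The product of the Green function bound, the weight in (P1) and the Lipschitz bound of the flow
  decays in s at rate \<theta> - (\<alpha> - a) - \<mu> for s \<le> t and at rate \<theta> +
  (\<alpha> - a) - \<mu> for s \<ge> t. These are the two denominators of the smallness condition,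
  and the condition on the maximum makes both positive. The integral over s \<le> t carries the
  factor exp((\<epsilon> + a - \<alpha>) t), which may grow; hence the restriction to small t. The
  integral over s \<ge> t carries exp((\<epsilon> + \<mu> - \<theta>) t), which is at most 1 because
  \<mu> + \<epsilon> \<le> \<theta>.

  The derivative of the flow is never constructed. Comparing increments takes only Gronwall's
  inequality, and the derivative of \<phi> appears afterwards as a limit of difference
  quotients.\<close>

locale vector_norm =
  fixes N :: "real^'n \<Rightarrow> real"
  assumes is_norm: "is_norm N"
begin

lemma N_eq_0 [simp]: "N x = 0 \<longleftrightarrow> x = 0"
  and N_add: "N (x + y) \<le> N x + N y"
  and N_scale [simp]: "N (r *\<^sub>R x) = \<bar>r\<bar> * N x"
  using is_norm unfolding is_norm_def by blast+

lemma N_zero [simp]: "N 0 = 0"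
  by simp

lemma N_minus [simp]: "N (- x) = N x"
  using N_scale[of "-1" x] by simp

lemma N_nonneg [simp]: "0 \<le> N x"
  using N_add[of x "- x"] by simp

lemma N_pos: "x \<noteq> 0 \<Longrightarrow> 0 < N x"
  using N_nonneg[of x] N_eq_0[of x] by linarith

lemma N_diff: "N (x - y) \<le> N x + N y"
  using N_add[of x "- y"] by simp

lemma N_sum: "finite I \<Longrightarrow> N (\<Sum>i\<in>I. g i) \<le> (\<Sum>i\<in>I. N (g i))"
proof (induction I rule: finite_induct)
  case (insert i I)
  then show ?case using N_add[of "g i" "\<Sum>i\<in>I. g i"] by simp
qed simp

lemma N_le_norm: obtains C where "C > 0" "\<And>x. N x \<le> C * norm x"
proof
  let ?C = "1 + (\<Sum>i\<in>Basis. N i)"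
  show "?C > 0" by (simp add: add_pos_nonneg sum_nonneg)
  fix x :: "real^'n"
  have "N x = N (\<Sum>i\<in>Basis. (x \<bullet> i) *\<^sub>R i)" by (simp add: euclidean_representation)
  also have "\<dots> \<le> (\<Sum>i\<in>Basis. N ((x \<bullet> i) *\<^sub>R i))" by (rule N_sum) simp
  also have "\<dots> \<le> (\<Sum>i\<in>Basis. norm x * N i)"
    by (rule sum_mono) (simp add: Basis_le_norm mult_right_mono)
  also have "\<dots> \<le> ?C * norm x" by (simp add: sum_distrib_left algebra_simps)
  finally show "N x \<le> ?C * norm x" .
qed

lemma N_reverse_triangle: "\<bar>N x - N y\<bar> \<le> N (x - y)"
  using N_add[of "x - y" y] N_add[of "y - x" x] N_minus[of "x - y"] by simp

lemma continuous_on_N: "continuous_on UNIV N"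
proof -
  obtain C where C: "C > 0" "\<And>x. N x \<le> C * norm x" using N_le_norm by blast
  have "C-lipschitz_on UNIV N"
    using C order_trans[OF N_reverse_triangle C(2)] by (auto intro!: lipschitz_onI simp: dist_norm)
  then show ?thesis by (rule lipschitz_on_continuous_on)
qed

lemma continuous_on_N_compose [continuous_intros]:
  "continuous_on S g \<Longrightarrow> continuous_on S (\<lambda>x. N (g x))"
  by (rule continuous_on_compose2[OF continuous_on_N]) auto

text \<open>By homogeneity a lower bound for \<open>N\<close> on the Euclidean unit sphere suffices,
  and there a positive minimum exists by compactness.\<close>

lemma norm_le_N: obtains C where "C > 0" "\<And>x. norm x \<le> C * N x"
proof -
  have "compact (sphere (0::real^'n) 1)" "sphere (0::real^'n) 1 \<noteq> {}" by auto
  then obtain u where u: "u \<in> sphere 0 1" "\<And>x. x \<in> sphere 0 1 \<Longrightarrow> N u \<le> N x"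
    using continuous_attains_inf[OF _ _ continuous_on_subset[OF continuous_on_N]]
    by (metis top_greatest)
  have pos: "N u > 0" using u(1) by (intro N_pos) auto
  have "norm x \<le> (1 / N u) * N x" for x
  proof (cases "x = 0")
    case False
    then have "N u \<le> N ((1 / norm x) *\<^sub>R x)" by (intro u(2)) simp
    then show ?thesis using pos False by (simp add: field_simps)
  qed simp
  then show ?thesis using pos that[of "1 / N u"] by simp
qed

text \<open>A real supremum is an upper bound only for a set that is bounded above; equivalence of
  norms and the Euclidean operator norm provide this before \<open>cSup_upper\<close>
  applies.\<close>

lemma mnorm_bound: "N (B *v x) \<le> mnorm N B * N x"
proof (cases "x = 0")
  case False
  obtain C where C: "C > 0" "\<And>x. N x \<le> C * norm x" using N_le_norm by blast
  obtain D where D: "D > 0" "\<And>x. norm x \<le> D * N x" using norm_le_N by blast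
  have bl: "bounded_linear ((*v) B)" by (rule matrix_vector_mul_bounded_linear)
  have "N (B *v z) \<le> C * (onorm ((*v) B) * D)" if "N z = 1" for z
  proof -
    have "norm (B *v z) \<le> onorm ((*v) B) * norm z" by (rule onorm[OF bl])
    also have "\<dots> \<le> onorm ((*v) B) * D"
      using D(2)[of z] that onorm_pos_le[OF bl] by (intro mult_left_mono) auto
    finally show ?thesis using C(2)[of "B *v z"] C(1) by (meson mult_le_cancel_left_pos order_trans)
  qed
  then have bdd: "bdd_above {N (B *v x) |x. N x = 1}" by (auto intro!: bdd_aboveI)
  have "N (B *v ((1 / N x) *\<^sub>R x)) \<le> mnorm N B"
    unfolding mnorm_def using False by (intro cSup_upper[OF _ bdd]) auto
  then show ?thesis
    using N_pos[OF False] by (simp add: matrix_vector_mult_scaleR field_simps)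
qed simp

text \<open>A finite-dimensional Hahn-Banach theorem: a hyperplane separates the open
  \<open>N\<close>-ball of radius \<open>N v\<close> from the boundary point \<open>v\<close>, and
  its normal is rescaled to take the value \<open>N v\<close> at \<open>v\<close>.\<close>

lemma supporting_functional:
  obtains l where "l \<bullet> v = N v" "\<And>x. l \<bullet> x \<le> N x"
proof (cases "v = 0")
  case True
  then show ?thesis using that[of 0] by simp
next
  case False
  then have Nv: "N v > 0" by (rule N_pos)
  let ?S = "{x. N x < N v}"
  have "convex ?S"
  proof (rule convexI)
    fix x y :: "real^'n" and p q :: real
    assume h: "x \<in> ?S" "y \<in> ?S" "0 \<le> p" "0 \<le> q" "p + q = 1"
    have "N (p *\<^sub>R x + q *\<^sub>R y) \<le> p * N x + q * N y"
      using N_add[of "p *\<^sub>R x" "q *\<^sub>R y"] h by simp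
    also have "\<dots> < N v" using h by (intro convex_bound_lt) auto
    finally show "p *\<^sub>R x + q *\<^sub>R y \<in> ?S" by simp
  qed
  moreover have "0 \<in> ?S" using Nv by simp
  ultimately obtain p r where p: "p \<noteq> 0" "\<And>x. x \<in> ?S \<Longrightarrow> p \<bullet> x \<le> r" "p \<bullet> v \<ge> r"
    using separating_hyperplane_sets[of ?S "{v}"] by auto
  have below: "p \<bullet> x \<le> p \<bullet> v" if "N x < N v" for x using p that by force
  \<comment> \<open>This multiple of \<open>p\<close> has \<open>N\<close>-norm
    \<open>N v / 2\<close>, hence lies in the ball; testing the separation on it gives
    \<open>p \<bullet> v > 0\<close>, which the rescaling divides by.\<close>
  define \<tau> where "\<tau> = N v / (2 * N p)"
  have \<tau>: "\<tau> > 0" "N (\<tau> *\<^sub>R p) < N v"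
    using Nv N_pos[OF p(1)] by (auto simp: \<tau>_def)
  have "0 < p \<bullet> (\<tau> *\<^sub>R p)" using p(1) \<tau>(1) by simp
  also have "\<dots> \<le> p \<bullet> v" using below[OF \<tau>(2)] .
  finally have pv: "0 < p \<bullet> v" .
  show ?thesis
  proof (rule that[of "(N v / (p \<bullet> v)) *\<^sub>R p"])
    show "(N v / (p \<bullet> v)) *\<^sub>R p \<bullet> v = N v" using pv by simp
    fix x :: "real^'n"
    show "(N v / (p \<bullet> v)) *\<^sub>R p \<bullet> x \<le> N x"
    \<comment> \<open>The ball is open, so \<open>x\<close> scaled to norm exactly
      \<open>N v\<close> is not admissible; dividing by \<open>N x + e\<close> moves it inside and
      also covers \<open>x = 0\<close>.\<close>
    proof (rule field_le_epsilon)
      fix e :: real assume e: "e > 0"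
      then have Ne: "N x + e > 0" using N_nonneg[of x] by linarith
      have "N v * (N x / (N x + e)) < N v * 1"
        using Nv Ne e by (intro mult_strict_left_mono) (auto simp: field_simps)
      then have "N ((N v / (N x + e)) *\<^sub>R x) < N v" using Nv Ne by (simp add: mult_ac)
      from below[OF this] show "(N v / (p \<bullet> v)) *\<^sub>R p \<bullet> x \<le> N x + e"
        using Ne pv by (simp add: field_simps)
    qed
  qed
qed

text \<open>Testing the integral with a functional that supports \<open>N\<close> at
  \<open>I\<close> reduces the claim to monotonicity of real integrals, without loss of a
  norm-equivalence constant.\<close>

lemma N_has_integral_le:
  fixes S :: "'a::euclidean_space set"
  assumes "(g has_integral I) S" "(h has_integral J) S" "\<And>s. s \<in> S \<Longrightarrow> N (g s) \<le> h s"
  shows "N I \<le> J"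
proof -
  obtain l where l: "l \<bullet> I = N I" "\<And>x. l \<bullet> x \<le> N x" using supporting_functional by blast
  have "((\<lambda>s. l \<bullet> g s) has_integral l \<bullet> I) S"
    using has_integral_linear[OF assms(1) bounded_linear_inner_right[of l]] by (simp add: o_def)
  then have "l \<bullet> I \<le> J"
    using assms(2) by (rule has_integral_le) (use l(2) assms(3) order_trans in blast)
  then show ?thesis using l by simp
qed

lemma N_derivative_le:
  assumes der: "(g has_derivative g') (at x)"
    and lip: "\<And>z. N (g z - g x) \<le> k * N (z - x)"
  shows "N (g' v) \<le> k * N v"
proof -
  have lin: "linear g'" using der by (simp add: has_derivative_bounded_linear bounded_linear.linear)
  obtain C where C: "C > 0" "\<And>x. N x \<le> C * norm x" using N_le_norm by blast
  show ?thesis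
  proof (rule field_le_epsilon)
    fix e :: real assume "e > 0"
    \<comment> \<open>Chosen so that the Euclidean remainder, once measured in \<open>N\<close> and
      divided by the step length \<open>h\<close>, is at most \<open>e\<close>.\<close>
    define e' where "e' = e / (C * (norm v + 1))"
    have nv: "norm v + 1 > 0" by (simp add: add_nonneg_pos)
    have e': "e' > 0" using \<open>e > 0\<close> C(1) nv by (simp add: e'_def)
    then obtain d where d: "d > 0"
      "\<And>z. norm (z - x) < d \<Longrightarrow> norm (g z - g x - g' (z - x)) \<le> e' * norm (z - x)"
      using der unfolding has_derivative_at_alt by blast
    define h where "h = d / (norm v + 1)"
    have h: "h > 0" using d(1) nv by (simp add: h_def)
    have "h * norm v < d" using d(1) nv by (simp add: h_def field_simps)
    then have "norm (g (x + h *\<^sub>R v) - g x - g' (h *\<^sub>R v)) \<le> e' * (h * norm v)"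
      using d(2)[of "x + h *\<^sub>R v"] h by simp
    then have r: "N (g (x + h *\<^sub>R v) - g x - g' (h *\<^sub>R v)) \<le> C * (e' * (h * norm v))"
      using C by (meson mult_le_cancel_left_pos order_trans)
    have "h * N (g' v) = N (g' (h *\<^sub>R v))" using h by (simp add: linear_cmul[OF lin])
    also have "\<dots> \<le> N (g (x + h *\<^sub>R v) - g x) + N (g (x + h *\<^sub>R v) - g x - g' (h *\<^sub>R v))"
      using N_diff[of "g (x + h *\<^sub>R v) - g x" "g (x + h *\<^sub>R v) - g x - g' (h *\<^sub>R v)"] by simp
    also have "\<dots> \<le> k * (h * N v) + C * (e' * (h * norm v))"
      using lip[of "x + h *\<^sub>R v"] h r by simp
    also have "\<dots> = h * (k * N v + C * (e' * norm v))" by (simp add: algebra_simps)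
    finally have "N (g' v) \<le> k * N v + C * (e' * norm v)" using h by simp
    moreover have "C * (e' * norm v) \<le> e"
      using C(1) nv \<open>e > 0\<close> by (simp add: e'_def divide_simps mult_pos_pos)
    ultimately show "N (g' v) \<le> k * N v + e" by linarith
  qed
qed

end

section \<open>Strict differentiability and diffeomorphisms near the identity\<close>

text \<open>A difference-quotient form of strict differentiability that does not mention the derivative: it can
  be verified for the flow without solving the variational equation.\<close>

definition proportional_increments :: "('a::real_normed_vector \<Rightarrow> 'b::real_normed_vector) \<Rightarrow> 'a \<Rightarrow> bool" where
  "proportional_increments g \<eta> \<longleftrightarrow> (\<forall>e>0. \<exists>r>0. \<forall>x\<in>ball \<eta> r. \<forall>x'\<in>ball \<eta> r. \<forall>z\<in>ball \<eta> r. \<forall>z'\<in>ball \<eta> r.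
     \<forall>k. x - x' = k *\<^sub>R (z - z') \<longrightarrow> norm (g x - g x' - k *\<^sub>R (g z - g z')) \<le> e * norm (x - x'))"

lemma eventually_add_divide_in_ball:
  fixes \<eta> v :: "'a::real_normed_vector"
  assumes "r > 0"
  shows "\<forall>\<^sub>F n in sequentially. \<eta> + (1 / real (Suc n)) *\<^sub>R v \<in> ball \<eta> r"
proof -
  have "(\<lambda>n. \<eta> + (1 / real (Suc n)) *\<^sub>R v) \<longlonglongrightarrow> \<eta> + 0 *\<^sub>R v"
    by (intro tendsto_intros LIMSEQ_Suc[OF lim_1_over_n])
  then have "\<forall>\<^sub>F n in sequentially. dist (\<eta> + (1 / real (Suc n)) *\<^sub>R v) \<eta> < r"
    using assms by (auto dest: tendstoD)
  then show ?thesis by (simp add: dist_commute)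
qed

lemma norm_le_all_epsilon_imp_0:
  fixes u :: "'a::real_normed_vector"
  assumes "\<And>e. e > 0 \<Longrightarrow> norm u \<le> e * B"
  shows "u = 0"
proof -
  have "norm u \<le> 0 + e" if "e > 0" for e
  proof -
    have "norm u \<le> e / (\<bar>B\<bar> + 1) * B" using that by (intro assms) simp
    also have "\<dots> \<le> e / (\<bar>B\<bar> + 1) * (\<bar>B\<bar> + 1)" using that by (intro mult_left_mono) auto
    also have "\<dots> = e" by (simp add: add_nonneg_pos less_imp_neq[symmetric])
    finally show ?thesis by simp
  qed
  then show ?thesis using field_le_epsilon[of "norm u" 0] by simp
qed

text \<open>The difference quotients in a direction \<open>v\<close> are compared with each other
  and with all increments parallel to \<open>v\<close> between points near \<eta>. The first
  comparison makes them Cauchy; the second shows that their limit approximates \<open>g\<close>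
  uniformly over base points, and this uniformity yields linearity.\<close>

lemma proportional_increments_strict_derivative:
  fixes g :: "'a::real_normed_vector \<Rightarrow> 'b::banach"
  assumes "proportional_increments g \<eta>"
  obtains l where "linear l"
    "\<And>e. e > 0 \<Longrightarrow> \<exists>r>0. \<forall>x\<in>ball \<eta> r. \<forall>x'\<in>ball \<eta> r. norm (g x - g x' - l (x - x')) \<le> e * norm (x - x')"
proof -
  define q where "q = (\<lambda>v n. real (Suc n) *\<^sub>R (g (\<eta> + (1 / real (Suc n)) *\<^sub>R v) - g \<eta>))"
  \<comment> \<open>The hypothesis is used with z = \<eta> + v/(n+1), z' = \<eta> and factor s(n+1),
    which turns the second increment into \<open>s\<close> times the quotient \<open>q v n\<close>.
    The radius depends on neither \<open>n\<close> nor \<open>v\<close>.\<close>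
  have q_close: "\<exists>r>0. \<forall>x\<in>ball \<eta> r. \<forall>x'\<in>ball \<eta> r. \<forall>s v. x - x' = s *\<^sub>R v \<longrightarrow>
      (\<forall>\<^sub>F n in sequentially. norm (g x - g x' - s *\<^sub>R q v n) \<le> e * norm (x - x'))" if "e > 0" for e
  proof -
    obtain r where r: "r > 0" and S: "\<And>x x' z z' k. \<lbrakk>x \<in> ball \<eta> r; x' \<in> ball \<eta> r; z \<in> ball \<eta> r; z' \<in> ball \<eta> r;
        x - x' = k *\<^sub>R (z - z')\<rbrakk> \<Longrightarrow> norm (g x - g x' - k *\<^sub>R (g z - g z')) \<le> e * norm (x - x')"
      using assms \<open>e > 0\<close> unfolding proportional_increments_def by meson
    show ?thesis
    proof (intro exI[of _ r] conjI r ballI allI impI)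
      fix x x' s v assume h: "x \<in> ball \<eta> r" "x' \<in> ball \<eta> r" "x - x' = s *\<^sub>R v"
      show "\<forall>\<^sub>F n in sequentially. norm (g x - g x' - s *\<^sub>R q v n) \<le> e * norm (x - x')"
        using eventually_add_divide_in_ball[OF r, of \<eta> v]
      proof eventually_elim
        case (elim n)
        then show ?case
          using S[of x x' "\<eta> + (1 / real (Suc n)) *\<^sub>R v" \<eta> "s * real (Suc n)"] h r by (simp add: q_def)
      qed
    qed
  qed
  have "Cauchy (q v)" for v
  proof (rule metric_CauchyI)
    fix e :: real assume e: "e > 0"
    define e' where "e' = e / (2 * (norm v + 1))"
    have nv: "norm v + 1 > 0" by (simp add: add_nonneg_pos)
    then have e': "e' > 0" using e by (simp add: e'_def)
    have small: "e' * norm v < e / 2" using e nv by (simp add: e'_def pos_divide_less_eq distrib_left)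
    obtain r where r: "r > 0" and Q: "\<And>x x' s v. \<lbrakk>x \<in> ball \<eta> r; x' \<in> ball \<eta> r; x - x' = s *\<^sub>R v\<rbrakk> \<Longrightarrow>
       (\<forall>\<^sub>F n in sequentially. norm (g x - g x' - s *\<^sub>R q v n) \<le> e' * norm (x - x'))"
      using q_close[OF e'] by meson
    \<comment> \<open>A single quotient \<open>q v m\<close> with its point inside the ball is the
      reference: all late quotients lie within \<open>e / 2\<close> of it.\<close>
    obtain m where m: "\<eta> + (1 / real (Suc m)) *\<^sub>R v \<in> ball \<eta> r"
      using eventually_add_divide_in_ball[OF r, of \<eta> v] by (auto simp: eventually_sequentially)
    let ?m = "real (Suc m)"
    have "\<forall>\<^sub>F n in sequentially. norm (g (\<eta> + (1 / ?m) *\<^sub>R v) - g \<eta> - (1 / ?m) *\<^sub>R q v n)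
        \<le> e' * norm ((1 / ?m) *\<^sub>R v)"
      using Q[of "\<eta> + (1 / ?m) *\<^sub>R v" \<eta> "1 / ?m" v] m r by simp
    then have "\<forall>\<^sub>F n in sequentially. dist (q v m) (q v n) < e / 2"
    proof eventually_elim
      case (elim n)
      have "q v m - q v n = ?m *\<^sub>R (g (\<eta> + (1 / ?m) *\<^sub>R v) - g \<eta> - (1 / ?m) *\<^sub>R q v n)"
        by (simp add: q_def scaleR_diff_right del: of_nat_Suc)
      then have "dist (q v m) (q v n) = ?m * norm (g (\<eta> + (1 / ?m) *\<^sub>R v) - g \<eta> - (1 / ?m) *\<^sub>R q v n)"
        by (simp only: dist_norm norm_scaleR abs_of_nat)
      also have "\<dots> \<le> ?m * (e' * norm ((1 / ?m) *\<^sub>R v))" using elim by (intro mult_left_mono) auto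
      also have "\<dots> = e' * norm v" by (simp del: of_nat_Suc)
      finally show ?case using small by linarith
    qed
    then obtain n0 where "\<And>n. n \<ge> n0 \<Longrightarrow> dist (q v m) (q v n) < e / 2"
      by (auto simp: eventually_sequentially)
    then show "\<exists>M. \<forall>m\<ge>M. \<forall>n\<ge>M. dist (q v m) (q v n) < e"
      by (metis dist_commute dist_triangle_half_r)
  qed
  moreover define l where "l = (\<lambda>v. lim (q v))"
  ultimately have l: "q v \<longlonglongrightarrow> l v" for v
    by (simp add: Cauchy_convergent_iff convergent_LIMSEQ_iff)
  have l_close: "\<exists>r>0. \<forall>x\<in>ball \<eta> r. \<forall>x'\<in>ball \<eta> r. \<forall>s v. x - x' = s *\<^sub>R v \<longrightarrow>
      norm (g x - g x' - s *\<^sub>R l v) \<le> e * norm (x - x')" if e: "e > 0" for e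
  proof -
    obtain r where r: "r > 0" and Q: "\<And>x x' s v. \<lbrakk>x \<in> ball \<eta> r; x' \<in> ball \<eta> r; x - x' = s *\<^sub>R v\<rbrakk> \<Longrightarrow>
       (\<forall>\<^sub>F n in sequentially. norm (g x - g x' - s *\<^sub>R q v n) \<le> e * norm (x - x'))"
      using q_close[OF e] by meson
    have "norm (g x - g x' - s *\<^sub>R l v) \<le> e * norm (x - x')"
      if "x \<in> ball \<eta> r" "x' \<in> ball \<eta> r" "x - x' = s *\<^sub>R v" for x x' s v
      by (rule tendsto_upperbound[OF _ Q[OF that] trivial_limit_sequentially])
         (intro tendsto_intros l)
    then show ?thesis using r by blast
  qed
  have "linear l"
  proof (rule linearI)
    fix v w
    have "l (v + w) - (l v + l w) = 0"
    proof (rule norm_le_all_epsilon_imp_0[where B = "norm (v + w) + norm v + norm w"])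
      fix e :: real assume "e > 0"
      then obtain r where r: "r > 0" and L: "\<And>x x' s v. \<lbrakk>x \<in> ball \<eta> r; x' \<in> ball \<eta> r; x - x' = s *\<^sub>R v\<rbrakk> \<Longrightarrow>
         norm (g x - g x' - s *\<^sub>R l v) \<le> e * norm (x - x')"
        using l_close by meson
      \<comment> \<open>Additivity comes from the triangle \<eta>, \<eta> + t v, \<eta> + t(v + w).
        Its side in direction \<open>w\<close> does not start at \<eta>, so the approximation at
        moving base points is essential.\<close>
      obtain m where m: "\<eta> + (1 / real (Suc m)) *\<^sub>R (v + w) \<in> ball \<eta> r" "\<eta> + (1 / real (Suc m)) *\<^sub>R v \<in> ball \<eta> r"
        using eventually_conj[OF eventually_add_divide_in_ball[OF r, of \<eta> "v + w"]
           eventually_add_divide_in_ball[OF r, of \<eta> v]] by (auto simp: eventually_sequentially)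
      define t where "t = 1 / real (Suc m)"
      have t: "t > 0" by (simp add: t_def)
      let ?x = "\<eta> + t *\<^sub>R (v + w)" and ?z = "\<eta> + t *\<^sub>R v"
      have x: "?x \<in> ball \<eta> r" "?z \<in> ball \<eta> r" "\<eta> \<in> ball \<eta> r"
        using m r unfolding t_def by simp_all
      have 1: "norm (g ?x - g \<eta> - t *\<^sub>R l (v + w)) \<le> e * (t * norm (v + w))"
        using L[OF x(1,3), of t "v + w"] t by simp
      have 2: "norm (g ?x - g ?z - t *\<^sub>R l w) \<le> e * (t * norm w)"
        using L[OF x(1,2), of t w] t by (simp add: scaleR_add_right)
      have 3: "norm (g ?z - g \<eta> - t *\<^sub>R l v) \<le> e * (t * norm v)"
        using L[OF x(2,3), of t v] t by simp
      have "t *\<^sub>R (l (v + w) - (l v + l w)) = (g ?x - g ?z - t *\<^sub>R l w) + (g ?z - g \<eta> - t *\<^sub>R l v)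
          - (g ?x - g \<eta> - t *\<^sub>R l (v + w))" by (simp add: algebra_simps)
      then have "norm (t *\<^sub>R (l (v + w) - (l v + l w))) \<le> e * (t * norm w) + e * (t * norm v) + e * (t * norm (v + w))"
        using norm_triangle_le_diff[OF add_mono[OF norm_triangle_mono[OF 2 3] 1]] by (simp only:)
      then have "t * norm (l (v + w) - (l v + l w)) \<le> e * (t * norm w) + e * (t * norm v) + e * (t * norm (v + w))"
        using t by simp
      also have "\<dots> = t * (e * (norm (v + w) + norm v + norm w))" by (simp add: algebra_simps)
      finally show "norm (l (v + w) - (l v + l w)) \<le> e * (norm (v + w) + norm v + norm w)" using t by simp
    qed
    then show "l (v + w) = l v + l w" by simp
  next
    fix k :: real and v
    have "l (k *\<^sub>R v) - k *\<^sub>R l v = 0"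
    proof (rule norm_le_all_epsilon_imp_0[where B = "2 * norm (k *\<^sub>R v)"])
      fix e :: real assume "e > 0"
      then obtain r where r: "r > 0" and L: "\<And>x x' s v. \<lbrakk>x \<in> ball \<eta> r; x' \<in> ball \<eta> r; x - x' = s *\<^sub>R v\<rbrakk> \<Longrightarrow>
         norm (g x - g x' - s *\<^sub>R l v) \<le> e * norm (x - x')"
        using l_close by meson
      obtain m where m: "\<eta> + (1 / real (Suc m)) *\<^sub>R (k *\<^sub>R v) \<in> ball \<eta> r"
        using eventually_add_divide_in_ball[OF r, of \<eta> "k *\<^sub>R v"] by (auto simp: eventually_sequentially)
      define t where "t = 1 / real (Suc m)"
      have t: "t > 0" by (simp add: t_def)
      let ?x = "\<eta> + t *\<^sub>R (k *\<^sub>R v)"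
      have x: "?x \<in> ball \<eta> r" "\<eta> \<in> ball \<eta> r" using m r by (simp_all add: t_def)
      \<comment> \<open>The same increment of \<open>g\<close> is read in two ways, as
        \<open>t\<close> times the direction \<open>k v\<close> and as \<open>t * k\<close> times
        the direction \<open>v\<close>.\<close>
      have 1: "norm (g ?x - g \<eta> - t *\<^sub>R l (k *\<^sub>R v)) \<le> e * (t * norm (k *\<^sub>R v))"
        using L[OF x, of t "k *\<^sub>R v"] t by (simp add: abs_mult mult.assoc)
      have 2: "norm (g ?x - g \<eta> - (t * k) *\<^sub>R l v) \<le> e * (t * norm (k *\<^sub>R v))"
        using L[OF x, of "t * k" v] t by (simp add: abs_mult mult.assoc)
      have "t *\<^sub>R (l (k *\<^sub>R v) - k *\<^sub>R l v) = (g ?x - g \<eta> - (t * k) *\<^sub>R l v) - (g ?x - g \<eta> - t *\<^sub>R l (k *\<^sub>R v))"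
        by (simp add: algebra_simps)
      then have "t * norm (l (k *\<^sub>R v) - k *\<^sub>R l v) \<le> e * (t * norm (k *\<^sub>R v)) + e * (t * norm (k *\<^sub>R v))"
        using norm_triangle_le_diff[OF add_mono[OF 2 1]] t by (metis abs_of_pos norm_scaleR)
      also have "\<dots> = t * (e * (2 * norm (k *\<^sub>R v)))" by (simp add: algebra_simps)
      finally show "norm (l (k *\<^sub>R v) - k *\<^sub>R l v) \<le> e * (2 * norm (k *\<^sub>R v))"
        using t mult_le_cancel_left_pos by blast
    qed
    then show "l (k *\<^sub>R v) = k *\<^sub>R l v" by simp
  qed
  moreover have "\<exists>r>0. \<forall>x\<in>ball \<eta> r. \<forall>x'\<in>ball \<eta> r. norm (g x - g x' - l (x - x')) \<le> e * norm (x - x')"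
    if "e > 0" for e
  proof -
    obtain r where r: "r > 0" and L: "\<forall>x\<in>ball \<eta> r. \<forall>x'\<in>ball \<eta> r. \<forall>s v. x - x' = s *\<^sub>R v \<longrightarrow>
         norm (g x - g x' - s *\<^sub>R l v) \<le> e * norm (x - x')"
      using l_close[OF \<open>e > 0\<close>] by blast
    have "norm (g x - g x' - l (x - x')) \<le> e * norm (x - x')" if "x \<in> ball \<eta> r" "x' \<in> ball \<eta> r" for x x'
      using L[rule_format, OF that, of 1 "x - x'"] by simp
    then show ?thesis using r by blast
  qed
  ultimately show ?thesis by (rule that)
qed

text \<open>Strict differentiability at every point forces a continuous derivative: for \<zeta> near
  \<eta>, the derivatives at \<zeta> and at \<eta> both approximate one and the same short increment
  starting at \<zeta>.\<close>

lemma proportional_increments_C1_map: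
  fixes g :: "real^'n \<Rightarrow> real^'n"
  assumes "\<And>\<eta>. proportional_increments g \<eta>"
  shows "C1_map g"
proof -
  have "\<forall>\<eta>. \<exists>l. linear l \<and> (\<forall>e>0. \<exists>r>0. \<forall>x\<in>ball \<eta> r. \<forall>x'\<in>ball \<eta> r.
      norm (g x - g x' - l (x - x')) \<le> e * norm (x - x'))"
    using proportional_increments_strict_derivative[OF assms] by metis
  then obtain l where lin: "\<And>\<eta>. linear (l \<eta>)"
    and l: "\<And>\<eta> e. e > 0 \<Longrightarrow> \<exists>r>0. \<forall>x\<in>ball \<eta> r. \<forall>x'\<in>ball \<eta> r.
      norm (g x - g x' - l \<eta> (x - x')) \<le> e * norm (x - x')" by metis
  have der: "(g has_derivative l \<eta>) (at \<eta>)" for \<eta>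
    unfolding has_derivative_at_alt
  proof (intro conjI allI impI)
    show "bounded_linear (l \<eta>)" using lin linear_conv_bounded_linear by blast
    fix e :: real assume "e > 0"
    then obtain r where "r > 0" "\<forall>x\<in>ball \<eta> r. \<forall>x'\<in>ball \<eta> r.
      norm (g x - g x' - l \<eta> (x - x')) \<le> e * norm (x - x')" using l by blast
    then show "\<exists>d>0. \<forall>y. norm (y - \<eta>) < d \<longrightarrow> norm (g y - g \<eta> - l \<eta> (y - \<eta>)) \<le> e * norm (y - \<eta>)"
      by (intro exI[of _ r]) (auto simp: dist_norm norm_minus_commute)
  qed
  have cont: "continuous_on UNIV (\<lambda>\<eta>. l \<eta> v)" for v
    unfolding continuous_on_iff
  proof (intro ballI allI impI)
    fix \<eta> and e :: real assume "e > 0"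
    define e' where "e' = e / (2 * (norm v + 1))"
    have nv: "norm v + 1 > 0" by (simp add: add_nonneg_pos)
    then have e': "e' > 0" using \<open>e > 0\<close> by (simp add: e'_def)
    have small: "2 * (e' * norm v) < e"
      using \<open>e > 0\<close> nv by (simp add: e'_def pos_divide_less_eq distrib_left)
    obtain r where r: "r > 0" and R: "\<And>x x'. x \<in> ball \<eta> r \<Longrightarrow> x' \<in> ball \<eta> r \<Longrightarrow>
      norm (g x - g x' - l \<eta> (x - x')) \<le> e' * norm (x - x')" using l[OF e'] by meson
    have "dist (l \<zeta> v) (l \<eta> v) < e" if "dist \<zeta> \<eta> < r" for \<zeta>
    proof -
      obtain r' where r': "r' > 0" and R': "\<And>x x'. x \<in> ball \<zeta> r' \<Longrightarrow> x' \<in> ball \<zeta> r' \<Longrightarrow>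
        norm (g x - g x' - l \<zeta> (x - x')) \<le> e' * norm (x - x')" using l[OF e'] by meson
      \<comment> \<open>Within this distance of \<zeta> a point lies both in the ball about \<zeta>
        and in the ball about \<eta>, so both approximations apply.\<close>
      define \<rho> where "\<rho> = min r' (r - dist \<zeta> \<eta>)"
      have \<rho>: "\<rho> > 0" using r' that by (simp add: \<rho>_def)
      obtain m where m: "\<zeta> + (1 / real (Suc m)) *\<^sub>R v \<in> ball \<zeta> \<rho>"
        using eventually_add_divide_in_ball[OF \<rho>, of \<zeta> v] by (auto simp: eventually_sequentially)
      define t where "t = 1 / real (Suc m)"
      have t: "t > 0" by (simp add: t_def)
      let ?x = "\<zeta> + t *\<^sub>R v"
      have dx: "dist \<zeta> ?x < \<rho>" using m by (simp add: t_def)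
      have 1: "norm (g ?x - g \<zeta> - l \<zeta> (?x - \<zeta>)) \<le> e' * norm (?x - \<zeta>)"
        using dx r' by (intro R') (auto simp: \<rho>_def)
      have "dist \<eta> ?x < r"
        using dist_triangle[of \<eta> ?x \<zeta>] dx by (simp add: \<rho>_def dist_commute)
      then have 2: "norm (g ?x - g \<zeta> - l \<eta> (?x - \<zeta>)) \<le> e' * norm (?x - \<zeta>)"
        using that by (intro R) (auto simp: dist_commute)
      have "t *\<^sub>R (l \<zeta> v - l \<eta> v) = (g ?x - g \<zeta> - l \<eta> (?x - \<zeta>)) - (g ?x - g \<zeta> - l \<zeta> (?x - \<zeta>))"
        by (simp add: linear_cmul[OF lin] algebra_simps)
      then have "t * norm (l \<zeta> v - l \<eta> v) \<le> e' * norm (?x - \<zeta>) + e' * norm (?x - \<zeta>)"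
        using norm_triangle_le_diff[OF add_mono[OF 2 1]] t by (metis abs_of_pos norm_scaleR)
      also have "\<dots> = t * (2 * (e' * norm v))" using t by (simp add: algebra_simps)
      finally have "norm (l \<zeta> v - l \<eta> v) \<le> 2 * (e' * norm v)"
        using t mult_le_cancel_left_pos by blast
      then show ?thesis using small by (simp add: dist_norm)
    qed
    then show "\<exists>d>0. \<forall>x'\<in>UNIV. dist x' \<eta> < d \<longrightarrow> dist (l x' v) (l \<eta> v) < e" using r by blast
  qed
  show ?thesis unfolding C1_map_def
  proof (intro exI[of _ "\<lambda>\<eta>. matrix (l \<eta>)"] conjI allI)
    show "(g has_derivative (\<lambda>h. matrix (l \<eta>) *v h)) (at \<eta>)" for \<eta>
      using der[of \<eta>] lin[of \<eta>] by (simp add: matrix_works)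
    show "continuous_on UNIV (\<lambda>\<eta>. matrix (l \<eta>))"
      unfolding matrix_def by (intro continuous_on_vec_lambda continuous_on_component cont)
  qed
qed

section \<open>Continuity of matrix inversion\<close>

lemma continuous_on_det:
  fixes B :: "'a::topological_space \<Rightarrow> real^'n^'n"
  assumes "continuous_on S B"
  shows "continuous_on S (\<lambda>x. det (B x))"
  unfolding det_def
  by (intro continuous_on_sum continuous_on_mult continuous_on_prod continuous_on_const continuous_on_component assms)

lemma matrix_inv_cancel:
  fixes B :: "real^'n^'n"
  assumes "invertible B"
  shows "B ** matrix_inv B = mat 1" "matrix_inv B ** B = mat 1"
  using someI_ex[OF assms[unfolded invertible_def]] unfolding matrix_inv_def by simp_all

text \<open>Cramer's rule, applied to the columns of the inverse, writes each entry as a quotient of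
  determinants, and continuity of the inverse can be read off from that.\<close>

lemma matrix_inv_cramer:
  fixes B :: "real^'n^'n"
  assumes "invertible B"
  shows "matrix_inv B = (\<chi> i j. det (\<chi> p q. if q = i then axis j 1 $ p else B $ p $ q) / det B)"
proof -
  have "matrix_inv B $ i $ j = det (\<chi> p q. if q = i then axis j 1 $ p else B $ p $ q) / det B" for i j
  proof -
    have "B *v (matrix_inv B *v axis j 1) = axis j 1"
      using assms by (simp add: matrix_vector_mul_assoc matrix_inv_cancel)
    then have "matrix_inv B *v axis j 1 = (\<chi> k. det (\<chi> p q. if q = k then axis j 1 $ p else B $ p $ q) / det B)"
      using cramer[of B "matrix_inv B *v axis j 1" "axis j 1"] assms invertible_det_nz by blast
    then have "(matrix_inv B *v axis j 1) $ i = det (\<chi> p q. if q = i then axis j 1 $ p else B $ p $ q) / det B"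
      by simp
    then show ?thesis by (simp add: matrix_vector_mult_basis column_def)
  qed
  then show ?thesis by (simp add: vec_eq_iff)
qed

lemma continuous_on_matrix_inv:
  fixes B :: "'a::topological_space \<Rightarrow> real^'n^'n"
  assumes B: "continuous_on S B" and inv: "\<And>x. x \<in> S \<Longrightarrow> invertible (B x)"
  shows "continuous_on S (\<lambda>x. matrix_inv (B x))"
proof -
  have "continuous_on S (\<lambda>x. \<chi> i j. det (\<chi> p q. if q = i then axis j 1 $ p else B x $ p $ q) / det (B x))"
  proof (intro continuous_on_vec_lambda continuous_on_divide continuous_on_det B)
    show "\<forall>x\<in>S. det (B x) \<noteq> 0" using inv invertible_det_nz by blast
    show "continuous_on S (\<lambda>x. if q = i then axis j 1 $ p else B x $ p $ q)" for i j p q :: 'n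
      by (cases "q = i") (auto intro!: continuous_on_component B continuous_on_const)
  qed
  then show ?thesis by (rule continuous_on_eq) (simp add: inv matrix_inv_cramer)
qed

section \<open>Perturbations of the identity by a C1 contraction\<close>

context vector_norm
begin

text \<open>\<open>T\<close> contracts in \<open>N\<close> but perhaps not in the Euclidean
  distance. A high iterate contracts in the latter, since \<open>q ^ k\<close> beats the constant
  \<open>D * C\<close>; \<open>T\<close> maps the unique fixed point of that iterate to another
  fixed point of it, hence to itself.\<close>

lemma contraction_fixpoint:
  assumes q: "0 \<le> q" "q < 1" and lip: "\<And>x y. N (T x - T y) \<le> q * N (x - y)"
  shows "\<exists>x. T x = x"
proof -
  obtain C where C: "C > 0" "\<And>x. N x \<le> C * norm x" using N_le_norm by blast
  obtain D where D: "D > 0" "\<And>x. norm x \<le> D * N x" using norm_le_N by blast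
  have iter: "N ((T ^^ k) x - (T ^^ k) y) \<le> q ^ k * N (x - y)" for k x y
  proof (induction k)
    case (Suc k)
    have "N ((T ^^ Suc k) x - (T ^^ Suc k) y) \<le> q * N ((T ^^ k) x - (T ^^ k) y)" using lip by simp
    also have "\<dots> \<le> q * (q ^ k * N (x - y))" using Suc q by (intro mult_left_mono) auto
    finally show ?case by simp
  qed simp
  have "(\<lambda>k. D * C * q ^ k) \<longlonglongrightarrow> D * C * 0"
    using q by (intro tendsto_intros LIMSEQ_power_zero) simp
  then have "\<forall>\<^sub>F k in sequentially. D * C * q ^ k < 1" by (rule order_tendstoD) simp
  then obtain k where k: "D * C * q ^ k < 1" by (auto simp: eventually_sequentially)
  have "dist ((T ^^ k) x) ((T ^^ k) y) \<le> (D * C * q ^ k) * dist x y" for x y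
  proof -
    have "norm ((T ^^ k) x - (T ^^ k) y) \<le> D * N ((T ^^ k) x - (T ^^ k) y)" by (rule D)
    also have "\<dots> \<le> D * (q ^ k * N (x - y))" using D(1) iter by (intro mult_left_mono) auto
    also have "\<dots> \<le> D * (q ^ k * (C * norm (x - y)))"
      using D(1) C q by (intro mult_left_mono) auto
    finally show ?thesis by (simp add: dist_norm mult_ac)
  qed
  then obtain x where x: "(T ^^ k) x = x" and uniq: "\<And>z. (T ^^ k) z = z \<Longrightarrow> z = x"
    using banach_fix_type[of "D * C * q ^ k" "T ^^ k"] k q(1) C(1) D(1) by (metis less_imp_le mult_nonneg_nonneg zero_le_power)
  have "(T ^^ k) (T x) = T x" using x by (metis funpow_swap1)
  then show ?thesis using uniq by blast
qed

text \<open>The lower bound \<open>expand\<close> has two uses: it makes \<open>G\<close> injective,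
  and it makes \<open>inv G\<close> Lipschitz. The resulting continuity of \<open>inv G\<close> is
  what the rule for the derivative of an inverse asks for, and it then also makes that derivative
  continuous.\<close>

lemma C1_diffeo_id_minus_contraction:
  assumes C1: "C1_map \<phi>" and q: "0 \<le> q" "q < 1"
    and lip: "\<And>x z. N (\<phi> x - \<phi> z) \<le> q * N (x - z)"
  shows "C1_diffeo (\<lambda>\<eta>. \<eta> - \<phi> \<eta>)"
proof -
  define G where "G = (\<lambda>\<eta>. \<eta> - \<phi> \<eta>)"
  obtain D\<phi> where der: "\<And>x. (\<phi> has_derivative (\<lambda>h. D\<phi> x *v h)) (at x)" and cont: "continuous_on UNIV D\<phi>"
    using C1 unfolding C1_map_def by blast
  obtain C where C: "C > 0" "\<And>x. N x \<le> C * norm x" using N_le_norm by blast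
  obtain D where D: "D > 0" "\<And>x. norm x \<le> D * N x" using norm_le_N by blast
  have expand: "(1 - q) * N (x - z) \<le> N (G x - G z)" for x z
    using N_diff[of "G x - G z" "\<phi> z - \<phi> x"] lip[of z x] N_minus[of "x - z"]
    by (simp add: G_def algebra_simps)
  have inj: "inj G"
  proof (rule injI)
    fix x z assume "G x = G z"
    then have "(1 - q) * N (x - z) \<le> 0" using expand[of x z] by simp
    then have "N (x - z) \<le> 0" using q by (simp add: mult_le_0_iff)
    then show "x = z" using N_nonneg[of "x - z"] by (simp add: order_antisym_conv)
  qed
  have surj: "surj G"
    unfolding surj_def
  proof
    fix w
    obtain x where "w + \<phi> x = x"
      using contraction_fixpoint[OF q, of "\<lambda>x. w + \<phi> x"] lip by auto
    then have "w = G x" by (simp add: G_def algebra_simps)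
    then show "\<exists>x. w = G x" ..
  qed
  have bij: "bij G" using inj surj by (simp add: bij_def)
  have G_inv: "G (inv G w) = w" for w using surj by (rule surj_f_inv_f)
  define B where "B = (\<lambda>x. mat 1 - D\<phi> x)"
  have B_der: "(G has_derivative (\<lambda>h. B x *v h)) (at x)" for x
    unfolding G_def B_def
    by (auto intro!: derivative_eq_intros der simp: matrix_vector_mult_diff_rdistrib)
  have B_cont: "continuous_on UNIV B"
    unfolding B_def by (intro continuous_intros cont)
  have B_inv: "invertible (B x)" for x
  proof -
    have "h = 0" if "B x *v h = 0" for h
    proof -
      have "D\<phi> x *v h = h" using that by (simp add: B_def matrix_vector_mult_diff_rdistrib)
      then have "N h \<le> q * N h" using N_derivative_le[OF der[of x] lip, of h] by simp
      then have "(1 - q) * N h \<le> 0" by (simp add: algebra_simps)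
      then have "N h \<le> 0" using q by (simp add: mult_le_0_iff)
      then show ?thesis using N_nonneg[of h] by (simp add: order_antisym_conv)
    qed
    then have "inj ((*v) (B x))" by (simp add: linear_injective_0)
    then show ?thesis using matrix_left_invertible_injective invertible_left_inverse by blast
  qed
  have inv_cont: "continuous_on UNIV (inv G)"
  proof -
    have "(D * C / (1 - q))-lipschitz_on UNIV (inv G)"
    proof (rule lipschitz_onI)
      fix x z
      have "norm (inv G x - inv G z) \<le> D * N (inv G x - inv G z)" by (rule D)
      also have "\<dots> \<le> D * (N (x - z) / (1 - q))"
        using expand[of "inv G x" "inv G z"] q D(1)
        by (intro mult_left_mono) (auto simp: G_inv pos_le_divide_eq mult.commute)
      also have "\<dots> \<le> D * (C * norm (x - z) / (1 - q))"
        using C D(1) q by (intro mult_left_mono divide_right_mono) auto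
      finally show "dist (inv G x) (inv G z) \<le> D * C / (1 - q) * dist x z" by (simp add: dist_norm)
    qed (use C D q in simp)
    then show ?thesis by (rule lipschitz_on_continuous_on)
  qed
  have "C1_map G" unfolding C1_map_def using B_der B_cont by blast
  moreover have "C1_map (inv G)" unfolding C1_map_def
  proof (intro exI[of _ "\<lambda>w. matrix_inv (B (inv G w))"] conjI allI)
    fix w
    show "(inv G has_derivative (*v) (matrix_inv (B (inv G w)))) (at w)"
    proof (rule has_derivative_inverse_basic[where T = UNIV])
      show "(G has_derivative (*v) (B (inv G w))) (at (inv G w))" by (rule B_der)
      show "(*v) (matrix_inv (B (inv G w))) \<circ> (*v) (B (inv G w)) = id"
        using matrix_inv_cancel(2)[OF B_inv] by (auto simp: fun_eq_iff matrix_vector_mul_assoc)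
      show "continuous (at w) (inv G)" using inv_cont by (simp add: continuous_on_eq_continuous_at)
    qed (auto simp: G_inv)
  next
    show "continuous_on UNIV (\<lambda>w. matrix_inv (B (inv G w)))"
      by (rule continuous_on_matrix_inv[OF continuous_on_compose2[OF B_cont inv_cont] B_inv]) auto
  qed
  ultimately show ?thesis using bij unfolding C1_diffeo_def G_def by blast
qed

end

section \<open>Gronwall's inequality and variation of constants\<close>

text \<open>The right-hand side \<open>U\<close> of the inequality satisfies U' \<le> w U, so U
  exp(-W) is nonincreasing. The antiderivative \<open>W\<close> is a parameter so that a closed form
  can be supplied later.\<close>

lemma gronwall_forward:
  fixes v w W :: "real \<Rightarrow> real"
  assumes ab: "p \<le> r"
    and v: "continuous_on {p..r} v" and w: "continuous_on {p..r} w"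
    and w0: "\<And>s. s \<in> {p..r} \<Longrightarrow> 0 \<le> w s"
    and W: "\<And>s. s \<in> {p..r} \<Longrightarrow> (W has_real_derivative w s) (at s within {p..r})"
    and ineq: "\<And>s. s \<in> {p..r} \<Longrightarrow> v s \<le> c + integral {p..s} (\<lambda>u. w u * v u)"
  shows "v r \<le> c * exp (W r - W p)"
proof -
  define U where "U = (\<lambda>s. c + integral {p..s} (\<lambda>u. w u * v u))"
  have U: "(U has_real_derivative w s * v s) (at s within {p..r})" if "s \<in> {p..r}" for s
    unfolding U_def
    using integral_has_real_derivative[OF continuous_on_mult[OF w v] that]
    by (auto intro!: derivative_eq_intros)
  have "((\<lambda>s. (w s * v s - U s * w s) * exp (- W s)) has_integral U r * exp (- W r) - U p * exp (- W p)) {p..r}"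
  proof (rule fundamental_theorem_of_calculus[OF ab])
    fix s assume s: "s \<in> {p..r}"
    have "((\<lambda>s. U s * exp (- W s)) has_real_derivative (w s * v s - U s * w s) * exp (- W s)) (at s within {p..r})"
      by (auto intro!: derivative_eq_intros U[OF s] W[OF s] simp: algebra_simps)
    then show "((\<lambda>s. U s * exp (- W s)) has_vector_derivative (w s * v s - U s * w s) * exp (- W s)) (at s within {p..r})"
      by (simp add: has_real_derivative_iff_has_vector_derivative)
  qed
  moreover have "(w s * v s - U s * w s) * exp (- W s) \<le> 0" if "s \<in> {p..r}" for s
  proof -
    have "w s * v s \<le> w s * U s" using ineq[OF that] w0[OF that] by (intro mult_left_mono) (auto simp: U_def)
    then show ?thesis by (intro mult_nonpos_nonneg) (auto simp: mult.commute)
  qed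
  ultimately have "U r * exp (- W r) - U p * exp (- W p) \<le> 0"
    using has_integral_le[OF _ has_integral_0] by blast
  moreover have "U p = c" by (simp add: U_def)
  ultimately have "U r * exp (- W r) * exp (W r) \<le> c * exp (- W p) * exp (W r)"
    by (intro mult_right_mono) auto
  then have "U r \<le> c * exp (W r - W p)"
    by (simp add: mult.assoc exp_add[symmetric])
  then show ?thesis using ineq[of r] ab by (simp add: U_def)
qed

text \<open>Time reversal of the forward case. The weight \<open>w (- s)\<close> has the
  antiderivative \<open>- W (- s)\<close>, so the exponent is again
  \<open>W r - W p\<close>.\<close>

lemma gronwall_backward:
  fixes v w W :: "real \<Rightarrow> real"
  assumes ab: "p \<le> r"
    and v: "continuous_on {p..r} v" and w: "continuous_on {p..r} w"
    and w0: "\<And>s. s \<in> {p..r} \<Longrightarrow> 0 \<le> w s"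
    and W: "\<And>s. s \<in> {p..r} \<Longrightarrow> (W has_real_derivative w s) (at s within {p..r})"
    and ineq: "\<And>s. s \<in> {p..r} \<Longrightarrow> v s \<le> c + integral {s..r} (\<lambda>u. w u * v u)"
  shows "v p \<le> c * exp (W r - W p)"
proof -
  have img: "uminus ` {-r..-p} = {p..r}" by simp
  have "v (- (- p)) \<le> c * exp (- W (- (- p)) - - W (- (- r)))"
  proof (rule gronwall_forward[where v = "\<lambda>s. v (- s)" and w = "\<lambda>s. w (- s)" and W = "\<lambda>s. - W (- s)"])
    show "continuous_on {-r..-p} (\<lambda>s. v (- s))" "continuous_on {-r..-p} (\<lambda>s. w (- s))"
      by (rule continuous_on_compose2[OF v] continuous_on_compose2[OF w]; force intro: continuous_intros)+
    fix s assume s: "s \<in> {-r..-p}"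
    then show "0 \<le> w (- s)" by (intro w0) auto
    have "(W \<circ> uminus has_real_derivative w (- s) * - 1) (at s within {-r..-p})"
      by (rule DERIV_image_chain) (use s img in \<open>auto intro!: W derivative_eq_intros\<close>)
    then show "((\<lambda>s. - W (- s)) has_real_derivative w (- s)) (at s within {-r..-p})"
      using DERIV_minus by (fastforce simp: o_def)
    have "integral {-r..s} (\<lambda>u. w (- u) * v (- u)) = integral {-s..r} (\<lambda>u. w u * v u)"
      using Henstock_Kurzweil_Integration.integral_reflect_real[of r "- s" "\<lambda>u. w u * v u"] by simp
    then show "v (- s) \<le> c + integral {-r..s} (\<lambda>u. w (- u) * v (- u))"
      using ineq[of "- s"] s by auto
  qed (use ab in auto)
  then show ?thesis by simp
qed

section \<open>Variation of constants in differential form\<close>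

lemma bounded_bilinear_matrix_vector_mult:
  "bounded_bilinear ((*v) :: real^'n^'m \<Rightarrow> real^'n \<Rightarrow> real^'m)"
  unfolding bilinear_conv_bounded_bilinear[symmetric] bilinear_def
  by (auto intro!: linearI simp: matrix_vector_mult_add_rdistrib matrix_vector_right_distrib
      scaleR_matrix_vector_assoc matrix_vector_mult_scaleR)

lemmas continuous_on_matrix_vector_mult =
  bounded_bilinear.continuous_on[OF bounded_bilinear_matrix_vector_mult]

lemma has_vector_derivative_within_iff_quotient:
  fixes f :: "real \<Rightarrow> 'a::real_normed_vector"
  shows "(f has_vector_derivative D) (at x within S) \<longleftrightarrow>
    ((\<lambda>u. (f u - f x) /\<^sub>R (u - x)) \<longlongrightarrow> D) (at x within S)"
proof -
  have "norm (f u - f x - (u - x) *\<^sub>R D) / norm (u - x) = norm ((f u - f x) /\<^sub>R (u - x) - D)"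
    if "u \<noteq> x" for u
  proof -
    have "(f u - f x) /\<^sub>R (u - x) - D = (f u - f x - (u - x) *\<^sub>R D) /\<^sub>R (u - x)"
      using that by (simp add: scaleR_diff_right)
    then show ?thesis by (simp add: divide_inverse mult.commute)
  qed
  then have "((\<lambda>u. norm (f u - f x - (u - x) *\<^sub>R D) / norm (u - x)) \<longlongrightarrow> 0) (at x within S) \<longleftrightarrow>
      ((\<lambda>u. norm ((f u - f x) /\<^sub>R (u - x) - D)) \<longlongrightarrow> 0) (at x within S)"
    by (intro Lim_cong_within) auto
  then show ?thesis
    unfolding has_vector_derivative_def has_derivative_iff_norm
    by (simp add: bounded_linear_scaleR_left tendsto_norm_zero_iff LIM_zero_iff)
qed

text \<open>Multiplication by the inverse of the fundamental matrix removes the homogeneous part of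
  the equation, which leaves only the forcing term \<open>g\<close>.\<close>

lemma has_vector_derivative_matrix_inv_mult:
  fixes X :: "real \<Rightarrow> real^'n^'n" and \<Delta> :: "real \<Rightarrow> real^'n"
  assumes s: "s \<in> S" and inv: "\<And>u. u \<in> S \<Longrightarrow> invertible (X u)"
    and contX: "continuous_on S X"
    and X: "(X has_vector_derivative (A ** X s)) (at s within S)"
    and \<Delta>: "(\<Delta> has_vector_derivative (A *v \<Delta> s + g)) (at s within S)"
  shows "((\<lambda>u. matrix_inv (X u) *v \<Delta> u) has_vector_derivative matrix_inv (X s) *v g) (at s within S)"
proof -
  define Z where "Z = (\<lambda>u. matrix_inv (X u))"
  have Z: "continuous_on S Z" unfolding Z_def by (rule continuous_on_matrix_inv[OF contX inv])
  have XZ: "X u *v (Z u *v h) = h" and ZX: "Z u *v (X u *v h) = h" if "u \<in> S" for u h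
    using matrix_inv_cancel[OF inv[OF that]] by (simp_all add: Z_def matrix_vector_mul_assoc)
  note lims = X[unfolded has_vector_derivative_within_iff_quotient] \<Delta>[unfolded has_vector_derivative_within_iff_quotient]
  have "(Z \<longlongrightarrow> Z s) (at s within S)" using Z s by (simp add: continuous_on)
  then have "((\<lambda>u. Z u *v (((\<Delta> u - \<Delta> s) /\<^sub>R (u - s)) - ((X u - X s) /\<^sub>R (u - s)) *v (Z s *v \<Delta> s))) \<longlongrightarrow>
     Z s *v ((A *v \<Delta> s + g) - (A ** X s) *v (Z s *v \<Delta> s))) (at s within S)"
    by (intro bounded_bilinear.tendsto[OF bounded_bilinear_matrix_vector_mult] tendsto_diff tendsto_const lims)
  moreover have "(A *v \<Delta> s + g) - (A ** X s) *v (Z s *v \<Delta> s) = g"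
    by (simp add: matrix_vector_mul_assoc[symmetric] XZ[OF s])
  \<comment> \<open>With the inverse taken at \<open>u\<close> outside and at \<open>s\<close>
    inside, the quotient involves increments of \<Delta> and \<open>X\<close> only. The limit thus
    needs continuity of the inverse, not its differentiability.\<close>
  moreover have "(Z u *v \<Delta> u - Z s *v \<Delta> s) /\<^sub>R (u - s)
      = Z u *v (((\<Delta> u - \<Delta> s) /\<^sub>R (u - s)) - ((X u - X s) /\<^sub>R (u - s)) *v (Z s *v \<Delta> s))"
    if "u \<in> S" for u
    by (simp add: matrix_vector_mult_diff_distrib matrix_vector_mult_diff_rdistrib
        scaleR_matrix_vector_assoc[symmetric] matrix_vector_mult_scaleR XZ[OF s] ZX[OF that] scaleR_diff_right)
  ultimately have "((\<lambda>u. (Z u *v \<Delta> u - Z s *v \<Delta> s) /\<^sub>R (u - s)) \<longlongrightarrow> Z s *v g) (at s within S)"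
    by (simp cong: Lim_cong_within)
  then show ?thesis unfolding has_vector_derivative_within_iff_quotient Z_def .
qed

section \<open>Dependence of the flow on initial values\<close>

locale perturbed_linear_system = vector_norm N
  for N :: "real^'n \<Rightarrow> real" +
  fixes A :: "real \<Rightarrow> real^'n^'n"
    and f :: "real \<Rightarrow> real^'n \<Rightarrow> real^'n"
    and X :: "real \<Rightarrow> real^'n^'n"
    and y :: "real \<Rightarrow> real \<Rightarrow> real^'n \<Rightarrow> real^'n"
    and Df :: "real \<Rightarrow> real^'n \<Rightarrow> real^'n^'n"
    and K0 a \<epsilon> Lf \<theta> :: real
  assumes X_inv: "0 \<le> t \<Longrightarrow> invertible (X t)"
    and X_deriv: "0 \<le> t \<Longrightarrow> (X has_vector_derivative (A t ** X t)) (at t within {0..})"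
    and y_init: "0 \<le> t \<Longrightarrow> y t t \<eta> = \<eta>"
    and y_deriv: "0 \<le> t \<Longrightarrow> 0 \<le> s \<Longrightarrow>
       ((\<lambda>s. y s t \<eta>) has_vector_derivative (A s *v y s t \<eta> + f s (y s t \<eta>))) (at s within {0..})"
    and growth: "0 \<le> t \<Longrightarrow> 0 \<le> s \<Longrightarrow> mnorm N (evol X t s) \<le> K0 * exp (a * \<bar>t - s\<bar> + \<epsilon> * s)"
    and f_lipschitz: "0 \<le> t \<Longrightarrow> N (f t y1 - f t y2) \<le> Lf * exp (- \<theta> * t) * N (y1 - y2)"
    and f_deriv: "0 \<le> t \<Longrightarrow> (f t has_derivative (\<lambda>h. Df t x *v h)) (at x)"
    and Df_cont: "continuous_on ({0..} \<times> UNIV) (\<lambda>(t, x). Df t x)"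
    and K0: "1 \<le> K0" and a: "0 < a" and Lf: "0 < Lf" and \<epsilon>: "0 \<le> \<epsilon>" "\<epsilon> < \<theta>"
begin

text \<open>The Gronwall factor: its exponent is the integral of K0 Lf exp(-(\<theta> - \<epsilon>)
  u) over the whole half-line, so it serves all pairs of times at once.\<close>

definition "E0 = exp (Lf * K0 / (\<theta> - \<epsilon>))"

lemma E0_ge_1: "1 \<le> E0"
  using Lf K0 \<epsilon> by (simp add: E0_def)

lemma continuous_on_X: "continuous_on {0..} X"
  by (rule continuous_on_vector_derivative[OF X_deriv]) simp

lemma evol_mult: "evol X s u *v h = X s *v (matrix_inv (X u) *v h)"
  by (simp add: evol_def matrix_vector_mul_assoc)

lemma evol_self: "0 \<le> s \<Longrightarrow> evol X s s *v h = h"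
  using matrix_inv_cancel(1)[OF X_inv] by (simp add: evol_def)

lemma evol_bound:
  assumes "0 \<le> s" "0 \<le> u"
  shows "N (evol X s u *v h) \<le> K0 * exp (a * \<bar>s - u\<bar> + \<epsilon> * u) * N h"
  using mnorm_bound[of "evol X s u" h] growth[OF assms] by (meson N_nonneg mult_right_mono order_trans)

text \<open>Variation of constants, divided by exp(a |r - t|). Adding the error level
  \<open>e\<close> to the normalised size of \<Delta> absorbs the inhomogeneous part of the bound on
  \<open>g\<close>, so the inequality has the pure Gronwall form. The minimum and maximum treat both
  time directions together.\<close>

lemma perturbation_integral_inequality:
  fixes \<Delta> g :: "real \<Rightarrow> real^'n"
  defines "w \<equiv> \<lambda>u. K0 * Lf * exp (- (\<theta> - \<epsilon>) * u)"
  assumes t: "0 \<le> t" and r: "0 \<le> r"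
    and \<Delta>: "\<And>u. 0 \<le> u \<Longrightarrow> (\<Delta> has_vector_derivative (A u *v \<Delta> u + g u)) (at u within {0..})"
    and g: "\<And>u. u \<in> {min r t..max r t} \<Longrightarrow> N (g u) \<le> Lf * exp (- \<theta> * u) * (N (\<Delta> u) + e * exp (a * \<bar>u - t\<bar>))"
  defines "v \<equiv> \<lambda>u. exp (- a * \<bar>u - t\<bar>) * N (\<Delta> u) + e"
  shows "v r \<le> K0 * exp (\<epsilon> * t) * N (\<Delta> t) + e + integral {min r t..max r t} (\<lambda>u. w u * v u)"
proof -
  let ?m = "min r t" and ?M = "max r t"
  let ?R = "exp (a * \<bar>r - t\<bar>)"
  have \<Delta>_cont: "continuous_on {0..} \<Delta>"
    by (rule continuous_on_vector_derivative[OF \<Delta>]) simp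
  define F where "F = (\<lambda>u. evol X r u *v \<Delta> u)"
  have F: "(F has_vector_derivative evol X r u *v g u) (at u within {0..})" if "0 \<le> u" for u
  proof -
    have "((\<lambda>u. matrix_inv (X u) *v \<Delta> u) has_vector_derivative matrix_inv (X u) *v g u) (at u within {0..})"
      using that by (intro has_vector_derivative_matrix_inv_mult[where A = "A u"] X_inv continuous_on_X X_deriv \<Delta>) auto
    from bounded_linear.has_vector_derivative[OF matrix_vector_mul_bounded_linear[of "X r"] this]
    show ?thesis by (simp add: F_def evol_mult)
  qed
  have "((\<lambda>u. evol X r u *v g u) has_integral F ?M - F ?m) {?m..?M}"
    by (rule fundamental_theorem_of_calculus) (use t r in \<open>auto intro!: has_vector_derivative_within_subset[OF F]\<close>)
  moreover have "((\<lambda>u. ?R * (w u * v u)) has_integral ?R * integral {?m..?M} (\<lambda>u. w u * v u)) {?m..?M}"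
    unfolding w_def v_def
    by (intro has_integral_mult_right integrable_integral integrable_continuous_interval continuous_intros
        continuous_on_subset[OF \<Delta>_cont]) (use t r in auto)
  moreover have "N (evol X r u *v g u) \<le> ?R * (w u * v u)" if u: "u \<in> {?m..?M}" for u
  proof -
    have u0: "0 \<le> u" using u t r by auto
    \<comment> \<open>Since \<open>u\<close> lies between \<open>r\<close> and \<open>t\<close>, the
      growth from \<open>t\<close> to \<open>u\<close> and from \<open>u\<close> to \<open>r\<close>
      combine to exactly the factor exp(a |r - t|) that is divided out.\<close>
    have split: "\<bar>r - t\<bar> = \<bar>r - u\<bar> + \<bar>u - t\<bar>" using u by (auto simp: min_def max_def split: if_splits)
    have "N (evol X r u *v g u) \<le> K0 * exp (a * \<bar>r - u\<bar> + \<epsilon> * u) * N (g u)"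
      by (rule evol_bound[OF r u0])
    also have "\<dots> \<le> K0 * exp (a * \<bar>r - u\<bar> + \<epsilon> * u) * (Lf * exp (- \<theta> * u) * (N (\<Delta> u) + e * exp (a * \<bar>u - t\<bar>)))"
      using K0 by (intro mult_left_mono g u) auto
    also have "N (\<Delta> u) + e * exp (a * \<bar>u - t\<bar>) = exp (a * \<bar>u - t\<bar>) * v u"
      by (simp add: v_def distrib_left exp_minus field_simps)
    also have "K0 * exp (a * \<bar>r - u\<bar> + \<epsilon> * u) * (Lf * exp (- \<theta> * u) * (exp (a * \<bar>u - t\<bar>) * v u)) =
      (exp (a * \<bar>r - u\<bar> + \<epsilon> * u) * exp (- \<theta> * u) * exp (a * \<bar>u - t\<bar>)) * (K0 * Lf * v u)"
      by (simp add: mult_ac)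
    also have "exp (a * \<bar>r - u\<bar> + \<epsilon> * u) * exp (- \<theta> * u) * exp (a * \<bar>u - t\<bar>) = ?R * exp (- (\<theta> - \<epsilon>) * u)"
      unfolding exp_add[symmetric] split by (simp add: algebra_simps)
    finally show ?thesis by (simp add: w_def mult_ac)
  qed
  ultimately have "N (F ?M - F ?m) \<le> ?R * integral {?m..?M} (\<lambda>u. w u * v u)"
    by (rule N_has_integral_le)
  moreover have "N (F ?M - F ?m) = N (F r - F t)"
    using N_minus[of "F r - F t"] by (simp add: min_def max_def)
  moreover have "N (F r) \<le> N (F t) + N (F r - F t)" using N_add[of "F t" "F r - F t"] by simp
  moreover have "N (F t) \<le> K0 * exp (a * \<bar>r - t\<bar> + \<epsilon> * t) * N (\<Delta> t)"
    unfolding F_def by (rule evol_bound[OF r t])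
  moreover have "F r = \<Delta> r" by (simp add: F_def evol_self[OF r])
  moreover have "exp (a * \<bar>r - t\<bar> + \<epsilon> * t) = ?R * exp (\<epsilon> * t)" by (rule exp_add)
  ultimately have "N (\<Delta> r) \<le> ?R * (K0 * exp (\<epsilon> * t) * N (\<Delta> t) + integral {?m..?M} (\<lambda>u. w u * v u))"
    by (simp add: algebra_simps)
  then have "exp (- a * \<bar>r - t\<bar>) * N (\<Delta> r) \<le> exp (- a * \<bar>r - t\<bar>) *
      (?R * (K0 * exp (\<epsilon> * t) * N (\<Delta> t) + integral {?m..?M} (\<lambda>u. w u * v u)))"
    by (rule mult_left_mono) simp
  also have "\<dots> = K0 * exp (\<epsilon> * t) * N (\<Delta> t) + integral {?m..?M} (\<lambda>u. w u * v u)"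
    by (simp add: mult.assoc[symmetric] exp_add[symmetric])
  finally show ?thesis by (simp add: v_def)
qed

lemma perturbation_bound:
  fixes \<Delta> g :: "real \<Rightarrow> real^'n"
  assumes t: "0 \<le> t" and s: "0 \<le> s" and e: "0 \<le> e"
    and \<Delta>: "\<And>u. 0 \<le> u \<Longrightarrow> (\<Delta> has_vector_derivative (A u *v \<Delta> u + g u)) (at u within {0..})"
    and g: "\<And>u. u \<in> {min s t..max s t} \<Longrightarrow> N (g u) \<le> Lf * exp (- \<theta> * u) * (N (\<Delta> u) + e * exp (a * \<bar>u - t\<bar>))"
  shows "N (\<Delta> s) \<le> exp (a * \<bar>s - t\<bar>) * (K0 * exp (\<epsilon> * t) * N (\<Delta> t) + e) * E0"
proof -
  define w where "w = (\<lambda>u. K0 * Lf * exp (- (\<theta> - \<epsilon>) * u))"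
  \<comment> \<open>This antiderivative of the weight vanishes at infinity, and on the half-line its
    values lie between -K0 Lf / (\<theta> - \<epsilon>) and 0. No difference of two of them exceeds
    the exponent of \<open>E0\<close>.\<close>
  define W where "W = (\<lambda>u. - (K0 * Lf / (\<theta> - \<epsilon>)) * exp (- (\<theta> - \<epsilon>) * u))"
  define v where "v = (\<lambda>u. exp (- a * \<bar>u - t\<bar>) * N (\<Delta> u) + e)"
  define c where "c = K0 * exp (\<epsilon> * t) * N (\<Delta> t) + e"
  let ?m = "min s t" and ?M = "max s t"
  have c0: "0 \<le> c" using K0 e by (simp add: c_def)
  have \<Delta>_cont: "continuous_on {0..} \<Delta>"
    by (rule continuous_on_vector_derivative[OF \<Delta>]) simp
  have v: "continuous_on {?m..?M} v"
    unfolding v_def by (intro continuous_intros continuous_on_subset[OF \<Delta>_cont]) (use t s in auto)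
  have w: "continuous_on {?m..?M} w" unfolding w_def by (intro continuous_intros)
  have w0: "0 \<le> w u" for u using K0 Lf by (simp add: w_def)
  have W: "(W has_real_derivative w u) (at u within S)" for u S
    unfolding W_def w_def using \<epsilon> by (auto intro!: derivative_eq_intros) (simp add: field_simps)
  have ineq: "v r \<le> c + integral {min r t..max r t} (\<lambda>u. w u * v u)" if "r \<in> {?m..?M}" for r
    unfolding v_def w_def c_def
    by (rule perturbation_integral_inequality[OF t _ \<Delta> g]) (use that s t in auto)
  have "v s \<le> c * exp (W ?M - W ?m)"
  proof (cases "t \<le> s")
    case True
    then have m: "?m = t" "?M = s" by auto
    show ?thesis unfolding m
      by (rule gronwall_forward[OF True v[unfolded m] w[unfolded m] w0 W]) (use ineq m in auto)
  next
    case False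
    then have m: "?m = s" "?M = t" and st: "s \<le> t" by auto
    show ?thesis unfolding m
      by (rule gronwall_backward[OF st v[unfolded m] w[unfolded m] w0 W]) (use ineq m in auto)
  qed
  also have "\<dots> \<le> c * E0"
  proof (intro mult_left_mono c0)
    have "W ?M \<le> 0" using K0 Lf \<epsilon> by (simp add: W_def)
    moreover have "- W ?m \<le> K0 * Lf / (\<theta> - \<epsilon>) * 1"
      unfolding W_def minus_mult_left[symmetric] minus_minus using K0 Lf \<epsilon> s t by (intro mult_left_mono) auto
    ultimately show "exp (W ?M - W ?m) \<le> E0" by (simp add: E0_def mult.commute)
  qed
  finally have "exp (- a * \<bar>s - t\<bar>) * N (\<Delta> s) \<le> c * E0" using e by (simp add: v_def)
  then have "exp (a * \<bar>s - t\<bar>) * (exp (- a * \<bar>s - t\<bar>) * N (\<Delta> s)) \<le> exp (a * \<bar>s - t\<bar>) * (c * E0)"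
    by (rule mult_left_mono) simp
  then show ?thesis by (simp add: mult.assoc[symmetric] exp_add[symmetric] c_def)
qed

text \<open>The difference of two solutions solves the linear equation with a forcing term that (P1)
  controls, which is the case \<open>e = 0\<close> of \<open>perturbation_bound\<close>.\<close>

lemma flow_lipschitz:
  assumes "0 \<le> t" "0 \<le> s"
  shows "N (y s t x - y s t z) \<le> K0 * E0 * exp (\<epsilon> * t) * exp (a * \<bar>s - t\<bar>) * N (x - z)"
proof -
  have "N (y s t x - y s t z) \<le> exp (a * \<bar>s - t\<bar>) * (K0 * exp (\<epsilon> * t) * N (y t t x - y t t z) + 0) * E0"
  proof (rule perturbation_bound[OF assms order.refl, where g = "\<lambda>u. f u (y u t x) - f u (y u t z)"])
    fix u :: real assume "0 \<le> u"
    from has_vector_derivative_diff[OF y_deriv[OF assms(1) this] y_deriv[OF assms(1) this], of x z]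
    show "((\<lambda>s. y s t x - y s t z) has_vector_derivative A u *v (y u t x - y u t z) + (f u (y u t x) - f u (y u t z)))
       (at u within {0..})"
      by (simp add: matrix_vector_mult_diff_distrib algebra_simps)
  qed (use assms f_lipschitz in auto)
  then show ?thesis by (simp add: y_init[OF assms(1)] mult_ac)
qed

section \<open>Linearisation along a trajectory on compact time intervals\<close>

lemma Df_bound: "0 \<le> t \<Longrightarrow> N (Df t x *v h) \<le> Lf * exp (- \<theta> * t) * N h"
  by (rule N_derivative_le[OF f_deriv]) (assumption, rule f_lipschitz)

text \<open>The mean value inequality is applied to \<open>f s\<close> minus its linear part at
  \<open>\<gamma> s\<close>. The derivative of this difference is uniformly small near \<gamma>,
  because \<open>Df\<close> is uniformly continuous on a compact set containing a tube around the
  curve.\<close>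

lemma uniform_linearization:
  assumes \<gamma>: "continuous_on {0..T} \<gamma>" and e: "0 < e"
  obtains \<rho> where "0 < \<rho>"
    "\<And>s p p'. s \<in> {0..T} \<Longrightarrow> N (p - \<gamma> s) < \<rho> \<Longrightarrow> N (p' - \<gamma> s) < \<rho> \<Longrightarrow>
       N (f s p - f s p' - Df s (\<gamma> s) *v (p - p')) \<le> e * N (p - p')"
proof -
  obtain C where C: "C > 0" "\<And>x. N x \<le> C * norm x" using N_le_norm by blast
  obtain D where D: "D > 0" "\<And>x. norm x \<le> D * N x" using norm_le_N by blast
  obtain Kb where Kb: "Kb > 0" "\<And>(B::real^'n^'n) (h::real^'n). norm (B *v h) \<le> norm B * norm h * Kb"
    using bounded_bilinear.pos_bounded[OF bounded_bilinear_matrix_vector_mult] by blast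
  have "bounded (\<gamma> ` {0..T})"
    using compact_continuous_image[OF \<gamma>] compact_imp_bounded by blast
  then obtain R where R: "\<And>s. s \<in> {0..T} \<Longrightarrow> norm (\<gamma> s) \<le> R" unfolding bounded_iff by blast
  \<comment> \<open>The extra 1 in the radius leaves room for points near the curve; the bound
    \<rho>0 \<le> 1 below keeps them inside.\<close>
  let ?Q = "{0..T} \<times> cball (0::real^'n) (R + 1)"
  define e' where "e' = e / (C * D * Kb)"
  have e': "e' > 0" using e C D Kb by (simp add: e'_def)
  have "compact ?Q" by (intro compact_Times) auto
  then have "uniformly_continuous_on ?Q (\<lambda>(t, x). Df t x)"
    by (intro compact_uniformly_continuous continuous_on_subset[OF Df_cont]) auto
  then obtain d where d: "d > 0" "\<And>q q'. q \<in> ?Q \<Longrightarrow> q' \<in> ?Q \<Longrightarrow> dist q' q < d \<Longrightarrow>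
      dist ((\<lambda>(t, x). Df t x) q') ((\<lambda>(t, x). Df t x) q) < e'"
    using e' unfolding uniformly_continuous_on_def by meson
  define \<rho>0 where "\<rho>0 = min d 1"
  have \<rho>0: "\<rho>0 > 0" using d by (simp add: \<rho>0_def)
  have lin: "N (f s p - f s p' - Df s (\<gamma> s) *v (p - p')) \<le> e * N (p - p')"
    if s: "s \<in> {0..T}" and p: "p \<in> ball (\<gamma> s) \<rho>0" "p' \<in> ball (\<gamma> s) \<rho>0" for s p p'
  proof -
    let ?\<psi> = "\<lambda>x. f s x - Df s (\<gamma> s) *v x"
    have \<psi>: "norm (?\<psi> p - ?\<psi> p') \<le> (e' * Kb) * norm (p - p')"
    proof (rule differentiable_bound[OF convex_ball[of "\<gamma> s" \<rho>0] _ _ p])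
      fix x assume x: "x \<in> ball (\<gamma> s) \<rho>0"
      show "(?\<psi> has_derivative (\<lambda>h. Df s x *v h - Df s (\<gamma> s) *v h)) (at x within ball (\<gamma> s) \<rho>0)"
        using s by (intro has_derivative_diff has_derivative_at_withinI[OF f_deriv]
            bounded_linear_imp_has_derivative matrix_vector_mul_bounded_linear) auto
      have "norm x \<le> R + 1"
        using x R[OF s] norm_triangle_sub[of x "\<gamma> s"] by (simp add: \<rho>0_def dist_norm norm_minus_commute)
      then have small: "norm (Df s x - Df s (\<gamma> s)) < e'"
        using d(2)[of "(s, \<gamma> s)" "(s, x)"] s x R[OF s]
        by (simp add: \<rho>0_def dist_Pair_Pair dist_commute flip: dist_norm)
      have "norm (Df s x *v h - Df s (\<gamma> s) *v h) \<le> e' * Kb * norm h" for h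
      proof -
        have "norm (Df s x *v h - Df s (\<gamma> s) *v h) \<le> norm (Df s x - Df s (\<gamma> s)) * norm h * Kb"
          using Kb(2)[of "Df s x - Df s (\<gamma> s)" h] by (simp add: matrix_vector_mult_diff_rdistrib)
        also have "\<dots> \<le> e' * norm h * Kb" using small Kb(1) by (intro mult_right_mono) auto
        finally show ?thesis by (simp add: mult_ac)
      qed
      then show "onorm (\<lambda>h. Df s x *v h - Df s (\<gamma> s) *v h) \<le> e' * Kb" by (rule onorm_le)
    qed
    have "N (f s p - f s p' - Df s (\<gamma> s) *v (p - p')) = N (?\<psi> p - ?\<psi> p')"
      by (simp add: matrix_vector_mult_diff_distrib algebra_simps)
    also have "\<dots> \<le> C * norm (?\<psi> p - ?\<psi> p')" by (rule C)
    also have "\<dots> \<le> C * ((e' * Kb) * norm (p - p'))"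
      by (rule mult_left_mono) (use C \<psi> in auto)
    also have "\<dots> \<le> C * ((e' * Kb) * (D * N (p - p')))"
      using C(1) e' Kb(1) D by (intro mult_left_mono) auto
    also have "\<dots> = e * N (p - p')" using C(1) D(1) Kb(1) by (simp add: e'_def)
    finally show ?thesis .
  qed
  show ?thesis
  proof (rule that[of "\<rho>0 / D"])
    show "\<rho>0 / D > 0" using \<rho>0 D by simp
    have ball: "p \<in> ball (\<gamma> s) \<rho>0" if "N (p - \<gamma> s) < \<rho>0 / D" for p s
    proof -
      have "D * N (p - \<gamma> s) < \<rho>0" using that D(1) by (simp add: pos_less_divide_eq mult.commute)
      then show ?thesis using D(2)[of "p - \<gamma> s"] by (simp add: dist_norm norm_minus_commute)
    qed
    fix s p p' assume "s \<in> {0..T}" "N (p - \<gamma> s) < \<rho>0 / D" "N (p' - \<gamma> s) < \<rho>0 / D"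
    then show "N (f s p - f s p' - Df s (\<gamma> s) *v (p - p')) \<le> e * N (p - p')"
      by (intro lin ball)
  qed
qed

text \<open>The error is measured with the weight Lf exp(-\<theta> s) exp(a |s - t|), the one that
  the Lipschitz estimate of the integrand also produces, so it can be integrated against the Green
  function by the same computation.\<close>

lemma flow_increments_nearly_proportional:
  assumes t: "0 \<le> t" "t \<le> T" and e: "0 < e"
  obtains \<rho> where "0 < \<rho>"
    "\<And>x x' z z' k s. N (x - \<eta>) < \<rho> \<Longrightarrow> N (x' - \<eta>) < \<rho> \<Longrightarrow> N (z - \<eta>) < \<rho> \<Longrightarrow> N (z' - \<eta>) < \<rho> \<Longrightarrow>
      x - x' = k *\<^sub>R (z - z') \<Longrightarrow> s \<in> {0..T} \<Longrightarrow>
      N (f s (y s t x) - f s (y s t x') - k *\<^sub>R (f s (y s t z) - f s (y s t z')))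
        \<le> e * (Lf * exp (- \<theta> * s) * exp (a * \<bar>s - t\<bar>) * N (x - x'))"
proof -
  define CT where "CT = K0 * E0 * exp (\<epsilon> * t) * exp (a * T)"
  have CT: "CT > 0" using K0 E0_ge_1 by (simp add: CT_def)
  have flow: "N (y s t x - y s t z) \<le> CT * N (x - z)" if "s \<in> {0..T}" for s x z
  proof -
    have "exp (a * \<bar>s - t\<bar>) \<le> exp (a * T)" using that t a by auto
    then have "K0 * E0 * exp (\<epsilon> * t) * exp (a * \<bar>s - t\<bar>) * N (x - z) \<le> CT * N (x - z)"
      unfolding CT_def using K0 E0_ge_1 by (intro mult_right_mono mult_left_mono) auto
    then show ?thesis using flow_lipschitz[OF t(1), of s x z] that by auto
  qed
  \<comment> \<open>The forcing term is bounded through \<open>E\<close> plus its error level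
    \<open>e2\<close>, and Gronwall bounds \<open>E\<close> by \<open>E0\<close> times that level.
    Division by \<open>E0 + 1\<close> makes the total \<open>e * N (x - x')\<close>.\<close>
  define \<kappa> where "\<kappa> = e / (E0 + 1)"
  have \<kappa>: "\<kappa> > 0" using e E0_ge_1 by (simp add: \<kappa>_def)
  \<comment> \<open>Two linearisation remainders, each at most \<open>e1 * CT * N (x - x')\<close>,
    must fit below Lf exp(-\<theta> u) \<open>e2\<close> for all u \<le> T; hence the factor 2 and
    the worst case u = T.\<close>
  define e1 where "e1 = Lf * exp (- \<theta> * T) * \<kappa> / (2 * CT)"
  have e1: "e1 > 0" using Lf \<kappa> CT by (simp add: e1_def)
  have "continuous_on {0..} (\<lambda>s. y s t \<eta>)"
    by (rule continuous_on_vector_derivative[OF y_deriv[OF t(1)]]) simp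
  then have "continuous_on {0..T} (\<lambda>s. y s t \<eta>)" by (rule continuous_on_subset) auto
  then obtain \<rho>1 where \<rho>1: "\<rho>1 > 0" and lin: "\<And>s p p'. s \<in> {0..T} \<Longrightarrow> N (p - y s t \<eta>) < \<rho>1 \<Longrightarrow> N (p' - y s t \<eta>) < \<rho>1 \<Longrightarrow>
       N (f s p - f s p' - Df s (y s t \<eta>) *v (p - p')) \<le> e1 * N (p - p')"
    using uniform_linearization[OF _ e1] by metis
  show ?thesis
  proof (rule that[of "\<rho>1 / CT"])
    show "\<rho>1 / CT > 0" using \<rho>1 CT by simp
    fix x x' z z' k s
    assume near: "N (x - \<eta>) < \<rho>1 / CT" "N (x' - \<eta>) < \<rho>1 / CT" "N (z - \<eta>) < \<rho>1 / CT" "N (z' - \<eta>) < \<rho>1 / CT"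
      and k: "x - x' = k *\<^sub>R (z - z')" and s: "s \<in> {0..T}"
    define E where "E = (\<lambda>u. y u t x - y u t x' - k *\<^sub>R (y u t z - y u t z'))"
    define g where "g = (\<lambda>u. f u (y u t x) - f u (y u t x') - k *\<^sub>R (f u (y u t z) - f u (y u t z')))"
    define e2 where "e2 = \<kappa> * N (x - x')"
    have e2: "0 \<le> e2" using \<kappa> by (simp add: e2_def)
    have rem: "N (f u (y u t p) - f u (y u t p') - Df u (y u t \<eta>) *v (y u t p - y u t p')) \<le> e1 * (CT * N (p - p'))"
      if "N (p - \<eta>) < \<rho>1 / CT" "N (p' - \<eta>) < \<rho>1 / CT" "u \<in> {0..T}" for p p' u
    proof -
      have "N (y u t q - y u t \<eta>) < \<rho>1" if "N (q - \<eta>) < \<rho>1 / CT" for q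
        using flow[OF \<open>u \<in> {0..T}\<close>, of q \<eta>] that CT by (simp add: pos_less_divide_eq mult.commute)
      then have "N (f u (y u t p) - f u (y u t p') - Df u (y u t \<eta>) *v (y u t p - y u t p')) \<le> e1 * N (y u t p - y u t p')"
        using that by (intro lin) auto
      also have "\<dots> \<le> e1 * (CT * N (p - p'))" using e1 flow that by (intro mult_left_mono) auto
      finally show ?thesis .
    qed
    have g_bound: "N (g u) \<le> Lf * exp (- \<theta> * u) * (N (E u) + e2 * exp (a * \<bar>u - t\<bar>))" if u: "u \<in> {0..T}" for u
    proof -
      let ?B = "Df u (y u t \<eta>)"
      let ?rx = "f u (y u t x) - f u (y u t x') - ?B *v (y u t x - y u t x')"
      let ?rz = "f u (y u t z) - f u (y u t z') - ?B *v (y u t z - y u t z')"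
      have "g u = ?B *v E u + (?rx - k *\<^sub>R ?rz)"
        by (simp add: g_def E_def matrix_vector_mult_diff_distrib matrix_vector_mult_scaleR algebra_simps)
      then have "N (g u) \<le> N (?B *v E u) + N (?rx - k *\<^sub>R ?rz)"
        using N_add[of "?B *v E u" "?rx - k *\<^sub>R ?rz"] by (simp only:)
      also have "\<dots> \<le> N (?B *v E u) + (N ?rx + N (k *\<^sub>R ?rz))"
        by (intro add_left_mono N_diff)
      also have "\<dots> \<le> Lf * exp (- \<theta> * u) * N (E u) + (e1 * (CT * N (x - x')) + e1 * (CT * N (x - x')))"
      proof (intro add_mono Df_bound rem near u)
        show "0 \<le> u" using u by simp
        \<comment> \<open>The factor \<open>k\<close> can be arbitrarily large, but \<bar>k\<bar>
          N(z - z') equals N(x - x'), so the scaled remainder obeys the same bound as the other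
          one.\<close>
        have "N (k *\<^sub>R ?rz) \<le> \<bar>k\<bar> * (e1 * (CT * N (z - z')))"
          unfolding N_scale by (intro mult_left_mono rem near u) simp
        then show "N (k *\<^sub>R ?rz) \<le> e1 * (CT * N (x - x'))" by (simp add: k mult_ac)
      qed
      also have "e1 * (CT * N (x - x')) + e1 * (CT * N (x - x')) = Lf * exp (- \<theta> * T) * (e2 * 1)"
        using CT by (simp add: e1_def e2_def)
      also have "\<dots> \<le> Lf * exp (- \<theta> * u) * (e2 * exp (a * \<bar>u - t\<bar>))"
        using Lf u \<epsilon> e2 a by (intro mult_mono mult_left_mono) auto
      finally show ?thesis by (simp add: distrib_left)
    qed
    have "N (E s) \<le> exp (a * \<bar>s - t\<bar>) * (K0 * exp (\<epsilon> * t) * N (E t) + e2) * E0"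
    proof (rule perturbation_bound[OF t(1) _ e2, where g = g])
      show "0 \<le> s" using s by simp
      show "N (g u) \<le> Lf * exp (- \<theta> * u) * (N (E u) + e2 * exp (a * \<bar>u - t\<bar>))" if "u \<in> {min s t..max s t}" for u
        using that s t by (intro g_bound) auto
      fix u :: real assume u: "0 \<le> u"
      show "(E has_vector_derivative A u *v E u + g u) (at u within {0..})"
        unfolding E_def g_def
        by (rule derivative_eq_intros y_deriv[OF t(1) u] refl)+
           (simp add: matrix_vector_mult_diff_distrib matrix_vector_mult_scaleR algebra_simps)
    qed
    also have "E t = 0" using k by (simp add: E_def y_init[OF t(1)])
    finally have Es: "N (E s) \<le> exp (a * \<bar>s - t\<bar>) * e2 * E0" by simp
    have "N (g s) \<le> Lf * exp (- \<theta> * s) * (exp (a * \<bar>s - t\<bar>) * e2 * E0 + e2 * exp (a * \<bar>s - t\<bar>))"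
      using Lf Es by (intro order_trans[OF g_bound[OF s]] mult_left_mono) auto
    also have "\<dots> = Lf * exp (- \<theta> * s) * exp (a * \<bar>s - t\<bar>) * (e2 * (E0 + 1))"
      by (simp add: algebra_simps)
    also have "e2 * (E0 + 1) = e * N (x - x')" using E0_ge_1 by (simp add: e2_def \<kappa>_def)
    finally show "N (f s (y s t x) - f s (y s t x') - k *\<^sub>R (f s (y s t z) - f s (y s t z')))
        \<le> e * (Lf * exp (- \<theta> * s) * exp (a * \<bar>s - t\<bar>) * N (x - x'))"
      by (simp add: g_def mult_ac)
  qed
qed

end

section \<open>The dichotomy and the conjugacy\<close>

locale dichotomous_system = perturbed_linear_system N A f X y Df K0 a \<epsilon> Lf \<theta>
  for N :: "real^'n \<Rightarrow> real" and A f X y Df K0 a \<epsilon> Lf \<theta> +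
  fixes P :: "real \<Rightarrow> real^'n^'n" and K \<alpha> \<mu> M \<delta> :: real
  assumes P_inv: "0 \<le> t \<Longrightarrow> 0 \<le> s \<Longrightarrow> P t ** evol X t s = evol X t s ** P s"
    and dich_stable: "0 \<le> s \<Longrightarrow> s \<le> t \<Longrightarrow> mnorm N (evol X t s ** P s) \<le> K * exp (- \<alpha> * (t - s) + \<mu> * s)"
    and dich_unstable: "0 \<le> t \<Longrightarrow> t \<le> s \<Longrightarrow>
      mnorm N (evol X t s ** (mat 1 - P s)) \<le> K * exp (\<alpha> * (t - s) + \<mu> * s)"
    and f_cont: "continuous_on ({0..} \<times> UNIV) (\<lambda>(t, x). f t x)"
    and f_bound: "0 \<le> t \<Longrightarrow> N (f t x) \<le> M * exp (\<delta> * t)"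
    and K: "1 \<le> K" and \<alpha>: "0 < \<alpha>" and integrable_rate: "\<delta> + \<mu> < \<alpha>"
    and rate1: "\<mu> + \<alpha> - a < \<theta>" and rate2: "\<mu> - (\<alpha> - a) < \<theta>"
begin

definition "integrand t \<eta> s = green X P t s *v f s (y s t \<eta>)"

definition "\<phi> t \<eta> = integral {0..} (integrand t \<eta>)"

text \<open>Product of the Green function bound, the Lipschitz weight in (P1) and the Lipschitz
  constant of the flow.\<close>

definition "lip_kernel t s = K * Lf * K0 * E0 * exp (\<epsilon> * t) * exp ((a - \<alpha>) * \<bar>s - t\<bar> + (\<mu> - \<theta>) * s)"

text \<open>Closed form of the integral of \<open>lip_kernel t\<close> over the half-line: the first
  summand comes from s \<le> t, the second from s \<ge> t.\<close>

definition "lip_const t = K * Lf * K0 * E0 / (\<theta> - (\<alpha> - a) - \<mu>) * (exp ((\<epsilon> + a - \<alpha>) * t) * (1 - exp (- (\<theta> - (\<alpha> - a) - \<mu>) * t)))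
   + K * Lf * K0 * E0 / (\<theta> + (\<alpha> - a) - \<mu>) * exp ((\<epsilon> + \<mu> - \<theta>) * t)"

section \<open>Bounds and integrability for the Green function integral\<close>

lemma green_bound:
  assumes "0 \<le> t" "0 \<le> s"
  shows "N (green X P t s *v h) \<le> K * exp (- \<alpha> * \<bar>s - t\<bar> + \<mu> * s) * N h"
proof (cases "s \<le> t")
  case True
  then have "N (green X P t s *v h) \<le> mnorm N (evol X t s ** P s) * N h"
    by (simp add: green_def mnorm_bound)
  also have "\<dots> \<le> K * exp (- \<alpha> * (t - s) + \<mu> * s) * N h"
    using dich_stable[of s t] assms True by (intro mult_right_mono) auto
  finally show ?thesis using True by simp
next
  case False
  then have "green X P t s *v h = - ((evol X t s ** (mat 1 - P s)) *v h)"
    by (simp add: green_def bounded_bilinear.minus_left[OF bounded_bilinear_matrix_vector_mult])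
  then have "N (green X P t s *v h) \<le> mnorm N (evol X t s ** (mat 1 - P s)) * N h"
    by (simp add: mnorm_bound)
  also have "\<dots> \<le> K * exp (\<alpha> * (t - s) + \<mu> * s) * N h"
    using dich_unstable[of t s] assms False by (intro mult_right_mono) auto
  finally show ?thesis using False by (simp add: algebra_simps)
qed

text \<open>Invariance of the projector moves it to the fixed time \<open>t\<close>, so both branches of the Green
  function are continuous in \<open>s\<close> although \<open>P\<close> is not assumed to be.\<close>

lemma green_mult:
  assumes "0 \<le> t" "0 \<le> s"
  shows "green X P t s *v h = (if s \<le> t then P t else P t - mat 1) *v (X t *v (matrix_inv (X s) *v h))"
proof -
  have "evol X t s ** P s = P t ** evol X t s" using P_inv[OF assms] by simp
  then have *: "(evol X t s ** P s) *v h = P t *v (evol X t s *v h)"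
    by (simp only: matrix_vector_mul_assoc)
  have "- (evol X t s ** (mat 1 - P s)) *v h = (evol X t s ** P s) *v h - evol X t s *v h"
    by (simp add: bounded_bilinear.minus_left[OF bounded_bilinear_matrix_vector_mult] matrix_vector_mul_assoc[symmetric]
        matrix_vector_mult_diff_rdistrib matrix_vector_mult_diff_distrib)
  then show ?thesis
    by (simp add: green_def * evol_mult matrix_vector_mult_diff_rdistrib)
qed

lemma continuous_on_pullback:
  assumes "0 \<le> t"
  shows "continuous_on {0..} (\<lambda>s. B *v (X t *v (matrix_inv (X s) *v f s (y s t \<eta>))))"
proof -
  have "continuous_on {0..} (\<lambda>s. y s t \<eta>)"
    by (rule continuous_on_vector_derivative[OF y_deriv[OF assms]]) simp
  then have "continuous_on {0..} (\<lambda>s. (\<lambda>(t, x). f t x) (s, y s t \<eta>))"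
    by (intro continuous_on_compose2[OF f_cont] continuous_intros) auto
  then show ?thesis
    by (intro continuous_on_matrix_vector_mult continuous_on_const continuous_on_matrix_inv continuous_on_X X_inv) auto
qed

text \<open>The integrand may jump at s = t, so bounded intervals are treated in two pieces. At
  infinity it is dominated by a multiple of exp(-(\<alpha> - \<mu> - \<delta>) s), whose rate is
  positive because \<delta> + \<mu> < \<alpha>.\<close>

lemma integrand_integrable:
  assumes t: "0 \<le> t"
  shows "integrand t \<eta> integrable_on {0..}"
proof -
  obtain D where D: "D > 0" "\<And>x. norm x \<le> D * N x" using norm_le_N by blast
  have integrand: "integrand t \<eta> s = (if s \<le> t then P t else P t - mat 1) *v (X t *v (matrix_inv (X s) *v f s (y s t \<eta>)))"
    if "0 \<le> s" for s unfolding integrand_def by (rule green_mult[OF t that])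
  have below: "integrand t \<eta> integrable_on {0..t}"
    by (rule integrable_eq[OF integrable_continuous_interval[OF continuous_on_subset[OF
       continuous_on_pullback[OF t, of "P t" \<eta>]]]]) (auto simp: integrand)
  \<comment> \<open>At s = t the Green function takes the value of the lower branch; this single
    point is negligible.\<close>
  have above: "integrand t \<eta> integrable_on {t..R}" for R
    by (rule integrable_spike[OF integrable_continuous_interval[OF continuous_on_subset[OF
       continuous_on_pullback[OF t, of "P t - mat 1" \<eta>]]] negligible_sing[of t]]) (use t in \<open>auto simp: integrand\<close>)
  show ?thesis
  proof (rule integrable_on_all_intervals_integrable_bound)
    fix p q :: real
    have "integrand t \<eta> integrable_on {0..max q t}"
      by (rule Henstock_Kurzweil_Integration.integrable_combine[OF _ _ below above]) (use t in auto)
    then have "integrand t \<eta> integrable_on {max 0 p..q}" by (rule integrable_on_subinterval) auto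
    moreover have "{0..} \<inter> cbox p q = {max 0 p..q}" by auto
    ultimately show "(\<lambda>s. if s \<in> {0..} then integrand t \<eta> s else 0) integrable_on cbox p q"
      by (simp only: integrable_restrict_Int)
  next
    show "(\<lambda>s. D * K * M * exp (\<alpha> * t) * exp (- (\<alpha> - \<mu> - \<delta>) * s)) integrable_on {0..}"
      using integrable_rate
      by (intro has_integral_integrable[OF has_integral_mult_right[OF has_integral_exp_minus_to_infinity]]) auto
    fix s :: real assume "s \<in> {0..}"
    then have s: "0 \<le> s" by simp
    have M0: "0 \<le> M" using order_trans[OF N_nonneg f_bound[of 0 0]] by simp
    have "norm (integrand t \<eta> s) \<le> D * N (integrand t \<eta> s)" by (rule D)
    also have "\<dots> \<le> D * (K * exp (- \<alpha> * \<bar>s - t\<bar> + \<mu> * s) * (M * exp (\<delta> * s)))"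
      unfolding integrand_def using D(1) K f_bound[OF s]
      by (intro mult_left_mono order_trans[OF green_bound[OF t s]]) auto
    also have "\<dots> = D * K * M * (exp (- \<alpha> * \<bar>s - t\<bar> + \<mu> * s) * exp (\<delta> * s))" by (simp add: mult_ac)
    also have "\<dots> \<le> D * K * M * (exp (\<alpha> * t) * exp (- (\<alpha> - \<mu> - \<delta>) * s))"
    proof (intro mult_left_mono)
      have "\<alpha> * (s - t) \<le> \<alpha> * \<bar>s - t\<bar>" using \<alpha> by (intro mult_left_mono) auto
      then show "exp (- \<alpha> * \<bar>s - t\<bar> + \<mu> * s) * exp (\<delta> * s) \<le> exp (\<alpha> * t) * exp (- (\<alpha> - \<mu> - \<delta>) * s)"
        unfolding exp_add[symmetric] exp_le_cancel_iff by (simp add: algebra_simps)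
    qed (use D K M0 in auto)
    finally show "norm (integrand t \<eta> s) \<le> D * K * M * exp (\<alpha> * t) * exp (- (\<alpha> - \<mu> - \<delta>) * s)" by (simp add: mult_ac)
  qed
qed

lemma has_integral_\<phi>: "0 \<le> t \<Longrightarrow> (integrand t \<eta> has_integral \<phi> t \<eta>) {0..}"
  unfolding \<phi>_def by (intro integrable_integral integrand_integrable)

section \<open>The Lipschitz constant of \<phi> at a fixed time\<close>

lemma lip_kernel_nonneg: "0 \<le> lip_kernel t s"
  using K Lf K0 E0_ge_1 by (simp add: lip_kernel_def)

text \<open>The case T = t yields the second summand of \<open>lip_const\<close>; large
  \<open>T\<close> yields the tail estimate for differentiability.\<close>

lemma lip_kernel_tail:
  assumes "t \<le> T"
  shows "(lip_kernel t has_integral K * Lf * K0 * E0 * exp ((\<epsilon> + \<alpha> - a) * t)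
     * (exp (- (\<theta> + (\<alpha> - a) - \<mu>) * T) / (\<theta> + (\<alpha> - a) - \<mu>))) {T..}"
proof -
  have "((\<lambda>s. K * Lf * K0 * E0 * exp ((\<epsilon> + \<alpha> - a) * t) * exp (- (\<theta> + (\<alpha> - a) - \<mu>) * s)) has_integral
     K * Lf * K0 * E0 * exp ((\<epsilon> + \<alpha> - a) * t)
     * (exp (- (\<theta> + (\<alpha> - a) - \<mu>) * T) / (\<theta> + (\<alpha> - a) - \<mu>))) {T..}"
    using rate2 by (intro has_integral_mult_right has_integral_exp_minus_to_infinity) auto
  then show ?thesis
    by (rule has_integral_eq[rotated])
       (use assms in \<open>auto simp: lip_kernel_def exp_add[symmetric] algebra_simps\<close>)
qed

lemma lip_kernel_integral:
  assumes t: "0 \<le> t"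
  shows "(lip_kernel t has_integral lip_const t) {0..}"
proof -
  let ?C = "K * Lf * K0 * E0" and ?k = "\<theta> - (\<alpha> - a) - \<mu>"
  have k: "?k > 0" using rate1 by simp
  have "((\<lambda>s. exp (- k * s)) has_integral - exp (- k * t) / k - (- exp (- k * 0) / k)) {0..t}" if "k > 0" for k
    using that t by (intro fundamental_theorem_of_calculus)
       (auto intro!: derivative_eq_intros simp flip: has_real_derivative_iff_has_vector_derivative)
  from has_integral_mult_right[OF this[OF k], of "?C * exp ((\<epsilon> + a - \<alpha>) * t)"]
  have "((\<lambda>s. ?C * exp ((\<epsilon> + a - \<alpha>) * t) * exp (- ?k * s)) has_integral
     ?C / ?k * (exp ((\<epsilon> + a - \<alpha>) * t) * (1 - exp (- ?k * t)))) {0..t}"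
    by (rule has_integral_eq_rhs) (use k in \<open>simp add: field_simps\<close>)
  then have 1: "(lip_kernel t has_integral ?C / ?k * (exp ((\<epsilon> + a - \<alpha>) * t) * (1 - exp (- ?k * t)))) {0..t}"
    by (rule has_integral_eq[rotated]) (auto simp: lip_kernel_def exp_add[symmetric] algebra_simps)
  have "exp ((\<epsilon> + \<alpha> - a) * t) * exp (- (\<theta> + (\<alpha> - a) - \<mu>) * t) = exp ((\<epsilon> + \<mu> - \<theta>) * t)"
    unfolding exp_add[symmetric] by (simp add: algebra_simps)
  then have 2: "(lip_kernel t has_integral ?C / (\<theta> + (\<alpha> - a) - \<mu>) * exp ((\<epsilon> + \<mu> - \<theta>) * t)) {t..}"
    using lip_kernel_tail[OF order.refl, of t] by (simp add: mult.assoc)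
  have "{0..t} \<inter> {t..} = {t}" "{0..t} \<union> {t..} = {0..}" using t by auto
  with has_integral_Un[OF 1 2] show ?thesis unfolding lip_const_def by simp
qed

lemma integrand_lipschitz:
  assumes "0 \<le> t" "0 \<le> s"
  shows "N (integrand t x s - integrand t z s) \<le> lip_kernel t s * N (x - z)"
proof -
  have "N (integrand t x s - integrand t z s) \<le> K * exp (- \<alpha> * \<bar>s - t\<bar> + \<mu> * s) * N (f s (y s t x) - f s (y s t z))"
    using green_bound[OF assms, of "f s (y s t x) - f s (y s t z)"]
    by (simp add: integrand_def matrix_vector_mult_diff_distrib)
  also have "\<dots> \<le> K * exp (- \<alpha> * \<bar>s - t\<bar> + \<mu> * s) * (Lf * exp (- \<theta> * s) *
      (K0 * E0 * exp (\<epsilon> * t) * exp (a * \<bar>s - t\<bar>) * N (x - z)))"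
    using K Lf flow_lipschitz[OF assms]
    by (intro mult_left_mono order_trans[OF f_lipschitz[OF assms(2)]]) auto
  also have "\<dots> = K * Lf * K0 * E0 * exp (\<epsilon> * t) *
      (exp (- \<alpha> * \<bar>s - t\<bar> + \<mu> * s) * exp (- \<theta> * s) * exp (a * \<bar>s - t\<bar>)) * N (x - z)"
    by (simp add: mult_ac)
  also have "exp (- \<alpha> * \<bar>s - t\<bar> + \<mu> * s) * exp (- \<theta> * s) * exp (a * \<bar>s - t\<bar>) = exp ((a - \<alpha>) * \<bar>s - t\<bar> + (\<mu> - \<theta>) * s)"
    unfolding exp_add[symmetric] by (simp add: algebra_simps)
  finally show ?thesis unfolding lip_kernel_def .
qed

lemma \<phi>_lipschitz:
  assumes "0 \<le> t"
  shows "N (\<phi> t x - \<phi> t z) \<le> lip_const t * N (x - z)"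
  by (rule N_has_integral_le[OF has_integral_diff[OF has_integral_\<phi> has_integral_\<phi>]
       has_integral_mult_left[OF lip_kernel_integral]]) (use assms integrand_lipschitz in auto)

text \<open>The increments of the integrand are nearly proportional only uniformly on compact time
  intervals. Up to \<open>T\<close> this is used; beyond \<open>T\<close> both increments are
  bounded separately by the Lipschitz kernel, whose tail is small.\<close>

lemma \<phi>_proportional_increments:
  assumes t: "0 \<le> t"
  shows "proportional_increments (\<phi> t) \<eta>"
  unfolding proportional_increments_def
proof (intro allI impI)
  fix e :: real assume e: "e > 0"
  obtain C where C: "C > 0" "\<And>x. N x \<le> C * norm x" using N_le_norm by blast
  obtain D where D: "D > 0" "\<And>x. norm x \<le> D * N x" using norm_le_N by blast
  define e' where "e' = e / (D * C)"
  have e': "e' > 0" using e C D by (simp add: e'_def)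
  define \<tau> where "\<tau> = (\<lambda>T. K * Lf * K0 * E0 * exp ((\<epsilon> + \<alpha> - a) * t)
     * (exp (- (\<theta> + (\<alpha> - a) - \<mu>) * T) / (\<theta> + (\<alpha> - a) - \<mu>)))"
  have "((\<lambda>T. exp (- (\<theta> + (\<alpha> - a) - \<mu>) * T)) \<longlongrightarrow> 0) at_top"
    using rate2 by (intro filterlim_compose[OF exp_at_bot] filterlim_tendsto_neg_mult_at_bot[OF tendsto_const]
        filterlim_ident) auto
  then have "(\<tau> \<longlongrightarrow> K * Lf * K0 * E0 * exp ((\<epsilon> + \<alpha> - a) * t) * (0 / (\<theta> + (\<alpha> - a) - \<mu>))) at_top"
    unfolding \<tau>_def using rate2 by (intro tendsto_mult tendsto_divide tendsto_const) auto
  \<comment> \<open>A quarter, because two increments are estimated on the tail; the other half of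
    \<open>e'\<close> is left for the interval up to \<open>T\<close>.\<close>
  then have "\<forall>\<^sub>F T in at_top. \<tau> T < e' / 4" using e' by (intro order_tendstoD) auto
  then have "\<forall>\<^sub>F T in at_top. \<tau> T < e' / 4 \<and> t \<le> T" using eventually_ge_at_top eventually_conj by blast
  then obtain T where T: "\<tau> T < e' / 4" "t \<le> T" using eventually_happens'[OF trivial_limit_at_top_linorder] by blast
  have J0: "0 \<le> lip_const t" using has_integral_nonneg[OF lip_kernel_integral[OF t]] lip_kernel_nonneg by blast
  \<comment> \<open>The added 1 keeps the denominator positive, as \<open>lip_const t\<close> is
    only known to be nonnegative.\<close>
  define e0 where "e0 = e' / (2 * (lip_const t + 1))"
  have e0: "e0 > 0" using e' J0 by (simp add: e0_def)
  have e0J: "e0 * lip_const t \<le> e' / 2" using e' J0 by (simp add: e0_def field_simps)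
  obtain \<rho> where \<rho>: "0 < \<rho>" and inc:
    "\<And>x x' z z' k s. N (x - \<eta>) < \<rho> \<Longrightarrow> N (x' - \<eta>) < \<rho> \<Longrightarrow> N (z - \<eta>) < \<rho> \<Longrightarrow> N (z' - \<eta>) < \<rho> \<Longrightarrow>
      x - x' = k *\<^sub>R (z - z') \<Longrightarrow> s \<in> {0..T} \<Longrightarrow>
      N (f s (y s t x) - f s (y s t x') - k *\<^sub>R (f s (y s t z) - f s (y s t z')))
        \<le> e0 * (Lf * exp (- \<theta> * s) * exp (a * \<bar>s - t\<bar>) * N (x - x'))"
    using flow_increments_nearly_proportional[OF t T(2) e0, of \<eta>] by metis
  have near: "N (x - \<eta>) < \<rho>" if "x \<in> ball \<eta> (\<rho> / C)" for x
  proof -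
    have "C * norm (x - \<eta>) < \<rho>"
      using that C(1) by (simp add: dist_norm norm_minus_commute pos_less_divide_eq mult.commute)
    then show ?thesis using C(2)[of "x - \<eta>"] by linarith
  qed
  show "\<exists>r>0. \<forall>x\<in>ball \<eta> r. \<forall>x'\<in>ball \<eta> r. \<forall>z\<in>ball \<eta> r. \<forall>z'\<in>ball \<eta> r.
     \<forall>k. x - x' = k *\<^sub>R (z - z') \<longrightarrow> norm (\<phi> t x - \<phi> t x' - k *\<^sub>R (\<phi> t z - \<phi> t z')) \<le> e * norm (x - x')"
  proof (intro exI[of _ "\<rho> / C"] conjI ballI allI impI)
    show "0 < \<rho> / C" using \<rho> C by simp
    fix x x' z z' k
    assume "x \<in> ball \<eta> (\<rho> / C)" "x' \<in> ball \<eta> (\<rho> / C)" "z \<in> ball \<eta> (\<rho> / C)" "z' \<in> ball \<eta> (\<rho> / C)"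
      and k: "x - x' = k *\<^sub>R (z - z')"
    then have inc': "N (f s (y s t x) - f s (y s t x') - k *\<^sub>R (f s (y s t z) - f s (y s t z')))
        \<le> e0 * (Lf * exp (- \<theta> * s) * exp (a * \<bar>s - t\<bar>) * N (x - x'))" if "s \<in> {0..T}" for s
      using that by (intro inc near) auto
    have "((\<lambda>s. integrand t x s - integrand t x' s - k *\<^sub>R (integrand t z s - integrand t z' s)) has_integral
        \<phi> t x - \<phi> t x' - k *\<^sub>R (\<phi> t z - \<phi> t z')) {0..}"
      using t by (intro has_integral_diff has_integral_cmul has_integral_\<phi>)
    moreover have "((\<lambda>s. (e0 * lip_kernel t s + (if s \<in> {T..} then 2 * lip_kernel t s else 0)) * N (x - x')) has_integral
        (e0 * lip_const t + 2 * \<tau> T) * N (x - x')) {0..}"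
    proof (intro has_integral_mult_left has_integral_add has_integral_mult_right lip_kernel_integral t)
      have "((\<lambda>s. 2 * lip_kernel t s) has_integral 2 * \<tau> T) {T..}"
        unfolding \<tau>_def by (intro has_integral_mult_right lip_kernel_tail T)
      then show "((\<lambda>s. if s \<in> {T..} then 2 * lip_kernel t s else 0) has_integral 2 * \<tau> T) {0..}"
        using t T(2) by (subst has_integral_restrict) auto
    qed
    moreover have "N (integrand t x s - integrand t x' s - k *\<^sub>R (integrand t z s - integrand t z' s))
        \<le> (e0 * lip_kernel t s + (if s \<in> {T..} then 2 * lip_kernel t s else 0)) * N (x - x')" if "s \<in> {0..}" for s
    proof (cases "s \<in> {T..}")
      case True
      have s: "0 \<le> s" using that by simp
      have "N (k *\<^sub>R (integrand t z s - integrand t z' s)) \<le> lip_kernel t s * N (x - x')"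
        using mult_left_mono[OF integrand_lipschitz[OF t s, of z z'], of "\<bar>k\<bar>"] by (simp add: k mult_ac)
      then have "N (integrand t x s - integrand t x' s - k *\<^sub>R (integrand t z s - integrand t z' s)) \<le> 2 * lip_kernel t s * N (x - x')"
        using integrand_lipschitz[OF t s, of x x'] N_diff[of "integrand t x s - integrand t x' s" "k *\<^sub>R (integrand t z s - integrand t z' s)"] by linarith
      also have "\<dots> \<le> (e0 * lip_kernel t s + 2 * lip_kernel t s) * N (x - x')"
        using e0 lip_kernel_nonneg[of t s] by (intro mult_right_mono) auto
      finally show ?thesis using True by simp
    next
      case False
      then have s: "s \<in> {0..T}" "0 \<le> s" using that by auto
      let ?d = "f s (y s t x) - f s (y s t x') - k *\<^sub>R (f s (y s t z) - f s (y s t z'))"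
      have "integrand t x s - integrand t x' s - k *\<^sub>R (integrand t z s - integrand t z' s) = green X P t s *v ?d"
        by (simp add: integrand_def matrix_vector_mult_diff_distrib matrix_vector_mult_scaleR)
      then have "N (integrand t x s - integrand t x' s - k *\<^sub>R (integrand t z s - integrand t z' s)) \<le> K * exp (- \<alpha> * \<bar>s - t\<bar> + \<mu> * s) * N ?d"
        using green_bound[OF t s(2), of ?d] by (simp only:)
      also have "\<dots> \<le> K * exp (- \<alpha> * \<bar>s - t\<bar> + \<mu> * s) * (e0 * (Lf * exp (- \<theta> * s) * exp (a * \<bar>s - t\<bar>) * N (x - x')))"
        using K by (intro mult_left_mono inc' s) auto
      \<comment> \<open>The explicit factor 1 is then enlarged to K0 E0 exp(\<epsilon> t), so that
        the bound becomes a multiple of \<open>lip_kernel\<close> and its known integral can be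
        reused.\<close>
      also have "\<dots> = 1 * (K * Lf * (exp (- \<alpha> * \<bar>s - t\<bar> + \<mu> * s) * exp (- \<theta> * s) * exp (a * \<bar>s - t\<bar>)) * (e0 * N (x - x')))"
        by (simp add: mult_ac)
      also have "exp (- \<alpha> * \<bar>s - t\<bar> + \<mu> * s) * exp (- \<theta> * s) * exp (a * \<bar>s - t\<bar>) = exp ((a - \<alpha>) * \<bar>s - t\<bar> + (\<mu> - \<theta>) * s)"
        unfolding exp_add[symmetric] by (simp add: algebra_simps)
      also have "1 * (K * Lf * exp ((a - \<alpha>) * \<bar>s - t\<bar> + (\<mu> - \<theta>) * s) * (e0 * N (x - x')))
        \<le> (K0 * E0 * exp (\<epsilon> * t)) * (K * Lf * exp ((a - \<alpha>) * \<bar>s - t\<bar> + (\<mu> - \<theta>) * s) * (e0 * N (x - x')))"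
      proof (rule mult_right_mono)
        have "1 * 1 * 1 \<le> K0 * E0 * exp (\<epsilon> * t)"
          using K0 E0_ge_1 \<epsilon> t by (intro mult_mono) auto
        then show "1 \<le> K0 * E0 * exp (\<epsilon> * t)" by simp
      qed (use K Lf e0 in auto)
      also have "\<dots> = e0 * lip_kernel t s * N (x - x')" by (simp add: lip_kernel_def mult_ac)
      finally show ?thesis using False by simp
    qed
    ultimately have "N (\<phi> t x - \<phi> t x' - k *\<^sub>R (\<phi> t z - \<phi> t z')) \<le> (e0 * lip_const t + 2 * \<tau> T) * N (x - x')"
      by (rule N_has_integral_le)
    also have "\<dots> \<le> e' * N (x - x')" using e0J T(1) by (intro mult_right_mono) auto
    also have "\<dots> \<le> e' * (C * norm (x - x'))" using e' C by (intro mult_left_mono) auto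
    finally have "D * N (\<phi> t x - \<phi> t x' - k *\<^sub>R (\<phi> t z - \<phi> t z')) \<le> D * (e' * (C * norm (x - x')))"
      using D(1) by (intro mult_left_mono) auto
    also have "\<dots> = e * norm (x - x')" using C(1) D(1) by (simp add: e'_def)
    finally show "norm (\<phi> t x - \<phi> t x' - k *\<^sub>R (\<phi> t z - \<phi> t z')) \<le> e * norm (x - x')"
      using D(2) order_trans by blast
  qed
qed

lemma C1_diffeo_id_minus_\<phi>:
  assumes "0 \<le> t" "lip_const t < 1"
  shows "C1_diffeo (\<lambda>\<eta>. \<eta> - \<phi> t \<eta>)"
proof (rule C1_diffeo_id_minus_contraction)
  show "C1_map (\<phi> t)" by (intro proportional_increments_C1_map \<phi>_proportional_increments assms)
  show "0 \<le> lip_const t" using has_integral_nonneg[OF lip_kernel_integral[OF assms(1)]] lip_kernel_nonneg by blast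
qed (use assms \<phi>_lipschitz in auto)

text \<open>The factor \<psi> of the first summand vanishes at t = 0, so by continuity it is at most
  1 for small t. Each summand is then at most 1/c, and c > 2 makes the sum less than 1.\<close>

lemma small_time_contraction:
  assumes c: "2 < c" and slow: "\<mu> + \<epsilon> \<le> \<theta>"
    and c1: "K * Lf * K0 * E0 / (\<theta> - (\<alpha> - a) - \<mu>) \<le> 1 / c"
    and c2: "K * Lf * K0 * E0 / (\<theta> + (\<alpha> - a) - \<mu>) \<le> 1 / c"
  obtains d where "0 < d" "\<And>t. 0 \<le> t \<Longrightarrow> t < d \<Longrightarrow> lip_const t < 1"
proof -
  let ?k = "\<theta> - (\<alpha> - a) - \<mu>"
  define \<psi> where "\<psi> = (\<lambda>t. exp ((\<epsilon> + a - \<alpha>) * t) * (1 - exp (- ?k * t)))"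
  have C0: "0 \<le> K * Lf * K0 * E0" using K Lf K0 E0_ge_1 by simp
  have "isCont \<psi> 0" unfolding \<psi>_def by (intro continuous_intros)
  then obtain d where d: "d > 0" "\<And>t. dist t 0 < d \<Longrightarrow> dist (\<psi> t) (\<psi> 0) < 1"
    unfolding continuous_at_eps_delta by (metis zero_less_one)
  have "lip_const t < 1" if "0 \<le> t" "t < d" for t
  proof -
    have "\<psi> t \<le> 1" using d(2)[of t] that by (simp add: \<psi>_def dist_real_def abs_less_iff)
    then have "K * Lf * K0 * E0 / ?k * \<psi> t \<le> K * Lf * K0 * E0 / ?k * 1"
      using C0 rate1 by (intro mult_left_mono) auto
    moreover have "K * Lf * K0 * E0 / (\<theta> + (\<alpha> - a) - \<mu>) * exp ((\<epsilon> + \<mu> - \<theta>) * t)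
        \<le> K * Lf * K0 * E0 / (\<theta> + (\<alpha> - a) - \<mu>) * 1"
      using C0 rate2 slow that by (intro mult_left_mono) (auto simp: mult_nonpos_nonneg)
    ultimately have "lip_const t \<le> 1 / c + 1 / c" using c1 c2 unfolding lip_const_def \<psi>_def by linarith
    also have "\<dots> < 1" using c by (simp add: field_simps)
    finally show ?thesis .
  qed
  then show ?thesis using d(1) that by blast
qed

end

theorem theorem2:
  fixes N :: "real^'n \<Rightarrow> real"
    and A :: "real \<Rightarrow> real^'n^'n"
    and f :: "real \<Rightarrow> real^'n \<Rightarrow> real^'n"
    and X :: "real \<Rightarrow> real^'n^'n"
    and P :: "real \<Rightarrow> real^'n^'n"
    and y :: "real \<Rightarrow> real \<Rightarrow> real^'n \<Rightarrow> real^'n"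
    and K \<alpha> \<mu> K0 a \<epsilon> Lf \<theta> M \<delta> b c :: real
  assumes norm: "is_norm N"
    and A_cont: "continuous_on {0..} A"
    and f_cont: "continuous_on ({0..} \<times> UNIV) (\<lambda>(t, x). f t x)"
    and X_fund: "\<forall>t\<ge>0. invertible (X t) \<and> (X has_vector_derivative (A t ** X t)) (at t within {0..})"
    and y_sol: "\<forall>t\<ge>0. \<forall>\<eta>. y t t \<eta> = \<eta> \<and>
        (\<forall>s\<ge>0. ((\<lambda>s. y s t \<eta>) has_vector_derivative (A s *v y s t \<eta> + f s (y s t \<eta>))) (at s within {0..}))"
    and y_unique: "\<forall>t\<ge>0. \<forall>\<eta>. \<forall>z. z t = \<eta> \<and>
        (\<forall>s\<ge>0. (z has_vector_derivative (A s *v z s + f s (z s))) (at s within {0..}))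
        \<longrightarrow> (\<forall>s\<ge>0. z s = y s t \<eta>)"
    \<comment> \<open>nonuniform exponential dichotomy (K, alpha, mu) with projector P\<close>
    and K: "K \<ge> 1" and \<alpha>: "\<alpha> > 0" and \<mu>: "0 \<le> \<mu>" "\<mu> < \<alpha>"
    and P_proj: "\<forall>t\<ge>0. P t ** P t = P t"
    and P_inv: "\<forall>t\<ge>0. \<forall>s\<ge>0. P t ** evol X t s = evol X t s ** P s"
    and dich1: "\<forall>t s. 0 \<le> s \<and> s \<le> t \<longrightarrow> mnorm N (evol X t s ** P s) \<le> K * exp (- \<alpha> * (t - s) + \<mu> * s)"
    and dich2: "\<forall>t s. 0 \<le> t \<and> t \<le> s \<longrightarrow> mnorm N (evol X t s ** (mat 1 - P s)) \<le> K * exp (\<alpha> * (t - s) + \<mu> * s)"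
    \<comment> \<open>nonuniform bounded growth (K0, a, epsilon)\<close>
    and K0: "K0 \<ge> 1" and a: "a > 0" and \<epsilon>: "\<epsilon> \<ge> 0"
    and growth: "\<forall>t\<ge>0. \<forall>s\<ge>0. mnorm N (evol X t s) \<le> K0 * exp (a * \<bar>t - s\<bar> + \<epsilon> * s)"
    \<comment> \<open>(P1), (P2), (P3)\<close>
    and Lf: "Lf > 0" and \<theta>: "\<theta> \<ge> 0"
    and P1: "\<forall>t\<ge>0. \<forall>y1 y2. N (f t y1 - f t y2) \<le> Lf * exp (- \<theta> * t) * N (y1 - y2)"
    and M: "M > 0" and \<delta>: "\<delta> \<ge> 0"
    and P2: "\<forall>t\<ge>0. \<forall>x. N (f t x) \<le> M * exp (\<delta> * t)"
    and P3: "\<exists>Df :: real \<Rightarrow> real^'n \<Rightarrow> real^'n^'n.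
        (\<forall>t\<ge>0. \<forall>x. (f t has_derivative (\<lambda>h. Df t x *v h)) (at x))
        \<and> continuous_on ({0..} \<times> UNIV) (\<lambda>(t, x). Df t x)"
    \<comment> \<open>conditions on b\<close>
    and b: "b > 0"
    and c1: "\<delta> + \<mu> < min b \<alpha>"
    and c2: "\<mu> \<le> \<theta>" "\<epsilon> < \<theta>" "\<alpha> + \<mu> - \<theta> + b > 0" "\<alpha> - \<mu> + \<theta> - b > 0"
    and c3: "K * Lf / (\<alpha> + \<mu> - \<theta> + b) + K * Lf / (\<alpha> - \<mu> + \<theta> - b) < 1"
    \<comment> \<open>additional conditions\<close>
    and c4: "max (\<mu> + \<alpha> - a) (\<mu> - (\<alpha> - a)) < \<theta>"
    and c5: "\<mu> + \<epsilon> \<le> \<theta>"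
    and c: "c > 2"
    and c6: "K * Lf * K0 * exp (Lf * K0 / (\<theta> - \<epsilon>))
        * max (1 / (\<theta> - (\<alpha> - a) - \<mu>)) (1 / (\<theta> + (\<alpha> - a) - \<mu>)) \<le> 1 / c"
  shows "\<exists>tc :: ereal. tc > 0 \<and>
    (\<forall>t. 0 \<le> t \<and> ereal t < tc \<longrightarrow>
       C1_diffeo (\<lambda>\<eta>. \<eta> - integral {0..} (\<lambda>s. green X P t s *v f s (y s t \<eta>))))"
proof -
  obtain Df where Df: "\<forall>t\<ge>0. \<forall>x. (f t has_derivative (\<lambda>h. Df t x *v h)) (at x)"
    and Df_cont: "continuous_on ({0..} \<times> UNIV) (\<lambda>(t, x). Df t x)"
    using P3 by blast
  interpret dichotomous_system N A f X y Df K0 a \<epsilon> Lf \<theta> P K \<alpha> \<mu> M \<delta>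
  proof unfold_locales
    show "\<delta> + \<mu> < \<alpha>" using c1 by simp
    show "\<mu> + \<alpha> - a < \<theta>" "\<mu> - (\<alpha> - a) < \<theta>" using c4 by simp_all
  qed (use assms Df Df_cont in \<open>simp_all\<close>)
  \<comment> \<open>Each of the two reciprocals lies below their maximum, so the single smallness
    hypothesis yields both bounds required of the summands.\<close>
  have const: "K * Lf * K0 * E0 / q \<le> 1 / c"
    if "1 / q \<le> max (1 / (\<theta> - (\<alpha> - a) - \<mu>)) (1 / (\<theta> + (\<alpha> - a) - \<mu>))" for q
  proof -
    have "K * Lf * K0 * E0 * (1 / q)
        \<le> K * Lf * K0 * E0 * max (1 / (\<theta> - (\<alpha> - a) - \<mu>)) (1 / (\<theta> + (\<alpha> - a) - \<mu>))"
      using that K Lf K0 E0_ge_1 by (intro mult_left_mono) auto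
    then show ?thesis using c6 by (simp add: E0_def)
  qed
  obtain d where d: "0 < d" "\<And>t. 0 \<le> t \<Longrightarrow> t < d \<Longrightarrow> lip_const t < 1"
    using small_time_contraction[OF c c5 const const] by (metis max.cobounded1 max.cobounded2)
  show ?thesis
  proof (intro exI[of _ "ereal d"] conjI allI impI)
    show "0 < ereal d" using d(1) by simp
    fix t assume "0 \<le> t \<and> ereal t < ereal d"
    then have "C1_diffeo (\<lambda>\<eta>. \<eta> - \<phi> t \<eta>)" using d(2) by (intro C1_diffeo_id_minus_\<phi>) auto
    then show "C1_diffeo (\<lambda>\<eta>. \<eta> - integral {0..} (\<lambda>s. green X P t s *v f s (y s t \<eta>)))"
      unfolding \<phi>_def integrand_def .
  qed
qed

end
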